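(* Let $\Pi$ be a symmetric node-edge-checkable LCL problem on undirected paths without input. If $\Pi$ can be solved in $O(\log^* n)$ rounds in the LOCAL model, then there exists an LCL problem $\Pi'$ on undirected paths with the same asymptotic round complexity as $\Pi$ in the LOCAL model, such that every solution of $\Pi'$ is also a solution of $\Pi$, and $\Pi'$ is $O(1)$-mendable.
   Context: A node-edge-checkable LCL on paths is a tuple $\Pi=(\Gamma,C_{\mathrm{edge}},C_{\mathrm{node}},C_{\mathrm{start}},C_{\mathrm{end}})$ with $\Gamma$ a finite set of labels, $C_{\mathrm{edge}},C_{\mathrm{node}}\subseteq\Gamma\times\Gamma$ and $C_{\mathrm{start}},C_{\mathrm{end}}\subseteq\Gamma$; each node outputs one label per incident edge (half-edge labels), the pair of labels at every degree-2 node must lie in $C_{\mathrm{node}}$, the pair of labels on the two halves of every edge must lie in $C_{\mathrm{edge}}$, and the labels at the two endpoints of the path must satisfy $C_{\mathrm{start}}$ and $C_{\mathrm{end}}$ respectively. $\Pi$ is symmetric if $C_{\mathrm{start}}=C_{\mathrm{end}}$ and $C_{\mathrm{edge}}$, $C_{\mathrm{node}}$ are symmetric relations. In general, an LCL problem is given by finite label sets and a verifier $\psi$ of constant radius $r$ whose verdict (happy/unhappy) at a node depends only on its labeled radius-$r$ neighborhood; a solution makes $\psi$ happy everywhere. For partial labelings with empty label $\bot$, the relaxed verifier $\psi^*$ is happy at $v$ if some node within distance $r$ of $v$ has label $\bot$, and otherwise agrees with $\psi$ on any completion. A $t$-mend of a $\psi^*$-accepted partial labeling $\lambda$ at $v$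 is a $\psi^*$-accepted partial labeling $\mu$ with $\mu(v)\neq\bot$, $\mu(u)=\bot\Rightarrow\lambda(u)=\bot$, and $\mu(u)\neq\lambda(u)\Rightarrow\mathrm{dist}(u,v)\le t$. $\Pi'$ is $O(1)$-mendable if some radius-$r$ verifier for $\Pi'$ (accepting exactly its solutions) admits a constant $t$ such that on every graph of the family, for every $\psi^*$-accepted partial labeling and every node $v$, a $t$-mend at $v$ exists. LOCAL model: nodes with unique identifiers communicate along edges in synchronous rounds with unbounded messages; round complexity is the number of rounds needed to output a valid solution. *)

theory Defs
  imports Main "HOL-Library.Landau_Symbols"
begin

function log_star :: "nat \<Rightarrow> nat" where
  "log_star n = (if n \<le> 1 then 0 else Suc (log_star (nat \<lfloor>log 2 (real n)\<rfloor>)))"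
  by auto
termination
proof (relation "measure id")
  fix n :: nat assume "\<not> n \<le> 1"
  hence n2: "real n \<ge> 2" by simp
  have "real n < 2 powr real n"
    by (metis of_nat_less_two_power powr_realpow zero_less_numeral of_nat_numeral)
  hence "log 2 (real n) < real n" using n2 by (subst log_less_iff) auto
  hence "\<lfloor>log 2 (real n)\<rfloor> < int n" by linarith
  thus "(nat \<lfloor>log 2 (real n)\<rfloor>, n) \<in> measure id" using n2 by auto
qed auto

declare log_star.simps[simp del]

text \<open>The undirected path on n nodes has nodes 0,...,n-1 and edges {i,i+1}.
  A half-edge labeling is L :: nat \<Rightarrow> 'g \<times> 'g, where fst (L i) is the label of node i
  on its edge towards i-1 and snd (L i) the label on its edge towards i+1
  (components for non-existent edges are ignored everywhere).\<close>

definition path_dist :: "nat \<Rightarrow> nat \<Rightarrow> nat" where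
  "path_dist u v = (if u \<le> v then v - u else u - v)"

definition necl_solution ::
  "('g \<times> 'g) set \<Rightarrow> ('g \<times> 'g) set \<Rightarrow> 'g set \<Rightarrow> 'g set \<Rightarrow> nat \<Rightarrow> (nat \<Rightarrow> 'g \<times> 'g) \<Rightarrow> bool" where
  "necl_solution Cedge Cnode Cstart Cend n L \<longleftrightarrow>
     (\<forall>i. Suc i < n \<longrightarrow> (snd (L i), fst (L (Suc i))) \<in> Cedge) \<and>
     (\<forall>i. 0 < i \<and> Suc i < n \<longrightarrow> (fst (L i), snd (L i)) \<in> Cnode) \<and>
     (2 \<le> n \<longrightarrow> snd (L 0) \<in> Cstart \<and> fst (L (n - 1)) \<in> Cend)"

definition symmetric_necl ::
  "('g \<times> 'g) set \<Rightarrow> ('g \<times> 'g) set \<Rightarrow> 'g set \<Rightarrow> 'g set \<Rightarrow> bool" where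
  "symmetric_necl Cedge Cnode Cstart Cend \<longleftrightarrow> Cstart = Cend \<and> sym Cedge \<and> sym Cnode"

text \<open>A labeled radius-r neighbourhood of v is the induced subpath on the nodes
  max(0,v-r)..min(n-1,v+r), given as the list of its edges from left to right, each edge
  carrying (label at its left endpoint, label at its right endpoint), together with the
  position of v in that subpath.  A verifier psi judges such views; since paths are
  undirected it must be invariant under reversing the view.\<close>

definition nbhd_edges :: "nat \<Rightarrow> nat \<Rightarrow> (nat \<Rightarrow> 'g \<times> 'g) \<Rightarrow> nat \<Rightarrow> ('g \<times> 'g) list" where
  "nbhd_edges r n L v = map (\<lambda>j. (snd (L j), fst (L (Suc j)))) [v - r ..< min (n - 1) (v + r)]"

definition nbhd_center :: "nat \<Rightarrow> nat \<Rightarrow> nat" where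
  "nbhd_center r v = v - (v - r)"

definition orientation_invariant :: "(('g \<times> 'g) list \<Rightarrow> nat \<Rightarrow> bool) \<Rightarrow> bool" where
  "orientation_invariant psi \<longleftrightarrow>
     (\<forall>es k. k \<le> length es \<longrightarrow> psi (rev (map prod.swap es)) (length es - k) = psi es k)"

definition lcl_happy :: "nat \<Rightarrow> (('g \<times> 'g) list \<Rightarrow> nat \<Rightarrow> bool) \<Rightarrow> nat \<Rightarrow> (nat \<Rightarrow> 'g \<times> 'g) \<Rightarrow> nat \<Rightarrow> bool" where
  "lcl_happy r psi n L v \<longleftrightarrow> psi (nbhd_edges r n L v) (nbhd_center r v)"

definition lcl_solution :: "nat \<Rightarrow> (('g \<times> 'g) list \<Rightarrow> nat \<Rightarrow> bool) \<Rightarrow> nat \<Rightarrow> (nat \<Rightarrow> 'g \<times> 'g) \<Rightarrow> bool" where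
  "lcl_solution r psi n L \<longleftrightarrow> (\<forall>v<n. lcl_happy r psi n L v)"

definition relaxed_happy ::
  "nat \<Rightarrow> (('g \<times> 'g) list \<Rightarrow> nat \<Rightarrow> bool) \<Rightarrow> nat \<Rightarrow> (nat \<Rightarrow> ('g \<times> 'g) option) \<Rightarrow> nat \<Rightarrow> bool" where
  "relaxed_happy r psi n lam v \<longleftrightarrow>
     (\<exists>u<n. path_dist u v \<le> r \<and> lam u = None) \<or> lcl_happy r psi n (\<lambda>u. the (lam u)) v"

definition relaxed_accepted ::
  "nat \<Rightarrow> (('g \<times> 'g) list \<Rightarrow> nat \<Rightarrow> bool) \<Rightarrow> nat \<Rightarrow> (nat \<Rightarrow> ('g \<times> 'g) option) \<Rightarrow> bool" where
  "relaxed_accepted r psi n lam \<longleftrightarrow> (\<forall>v<n. relaxed_happy r psi n lam v)"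

definition is_mend ::
  "nat \<Rightarrow> (('g \<times> 'g) list \<Rightarrow> nat \<Rightarrow> bool) \<Rightarrow> nat \<Rightarrow> nat \<Rightarrow> (nat \<Rightarrow> ('g \<times> 'g) option) \<Rightarrow> nat
     \<Rightarrow> (nat \<Rightarrow> ('g \<times> 'g) option) \<Rightarrow> bool" where
  "is_mend r psi t n lam v mu \<longleftrightarrow>
     relaxed_accepted r psi n mu \<and> mu v \<noteq> None \<and>
     (\<forall>u<n. mu u = None \<longrightarrow> lam u = None) \<and>
     (\<forall>u<n. mu u \<noteq> lam u \<longrightarrow> path_dist u v \<le> t)"

definition O1_mendable :: "nat \<Rightarrow> (('g \<times> 'g) list \<Rightarrow> nat \<Rightarrow> bool) \<Rightarrow> bool" where
  "O1_mendable r0 psi0 \<longleftrightarrow>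
     (\<exists>r psi t. orientation_invariant psi \<and>
        (\<forall>n L. lcl_solution r psi n L \<longleftrightarrow> lcl_solution r0 psi0 n L) \<and>
        (\<forall>n lam v. v < n \<longrightarrow> relaxed_accepted r psi n lam \<longrightarrow> (\<exists>mu. is_mend r psi t n lam v mu)))"

text \<open>After T rounds, node i of the n-node path with identifiers id knows n, its own identifier
  and the identifiers of the nodes within distance T on either side (ordered outwards).
  An algorithm maps (n, (one side, own id, other side)) to (label on the edge towards the first
  side, label on the edge towards the other side).  Since the path is unoriented, the output must
  be consistent under exchanging the two sides.\<close>

definition local_view :: "nat \<Rightarrow> nat \<Rightarrow> (nat \<Rightarrow> nat) \<Rightarrow> nat \<Rightarrow> nat list \<times> nat \<times> nat list" where
  "local_view T n ids i = (rev (map ids [i - T ..< i]), ids i, map ids [Suc i ..< min n (Suc (i + T))])"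

definition unoriented_alg :: "(nat \<Rightarrow> nat list \<times> nat \<times> nat list \<Rightarrow> 'g \<times> 'g) \<Rightarrow> bool" where
  "unoriented_alg A \<longleftrightarrow> (\<forall>n xs x ys. A n (ys, x, xs) = prod.swap (A n (xs, x, ys)))"

definition valid_ids :: "nat \<Rightarrow> nat \<Rightarrow> (nat \<Rightarrow> nat) \<Rightarrow> bool" where
  "valid_ids c n ids \<longleftrightarrow> inj_on ids {..<n} \<and> ids ` {..<n} \<subseteq> {1..n ^ c}"

definition solvable_in_rounds ::
  "nat \<Rightarrow> (nat \<Rightarrow> (nat \<Rightarrow> 'g \<times> 'g) \<Rightarrow> bool) \<Rightarrow> nat \<Rightarrow> nat \<Rightarrow> bool" where
  "solvable_in_rounds c P n T \<longleftrightarrow>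
     (\<exists>A :: nat \<Rightarrow> nat list \<times> nat \<times> nat list \<Rightarrow> 'g \<times> 'g. unoriented_alg A \<and>
        (\<forall>ids. valid_ids c n ids \<longrightarrow> P n (\<lambda>i. A n (local_view T n ids i))))"

text \<open>Deterministic round complexity on n-node paths (meaningful when solvable).\<close>
definition round_complexity :: "nat \<Rightarrow> (nat \<Rightarrow> (nat \<Rightarrow> 'g \<times> 'g) \<Rightarrow> bool) \<Rightarrow> nat \<Rightarrow> nat" where
  "round_complexity c P n = (LEAST T. solvable_in_rounds c P n T)"

end

theory Submission
  imports Defs "HOL-Real_Asymp.Real_Asymp"
begin

text \<open>A node is in state (a, b) if a and b are its labels towards its left and right neighbour; reversing
  the path swaps the components. An algorithm that is much faster than n must use, far from the
  endpoints, only flexible states: the outputs on disjoint windows of identifiers can be placed in any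
  order and at any distance on a common path, so they lie in one strongly connected, aperiodic,
  mirror-closed component of the transition graph, which is also reachable from an endpoint. The
  restricted problem demands, on long paths, states of one such component D at all nodes of distance
  at least h from both ends. Any two states of D are joined by walks of every length from some K on,
  so every hole can be refilled after erasing a constant number of labels on both sides.

  For the round complexity no lower bound is needed. If some flexible state is a loop, choose its
  component: pointers to the largest identifier within constant distance orient the path in long
  consistent runs, on which the loop is repeated. Otherwise the given algorithm never outputs the same
  state at two adjacent nodes; running it on the subpaths of stride 1, ..., K + 1 colours a power of
  the path with constantly many colours, and a greedy maximal independent set yields nodes at bounded
  distances of at least K. Between the chosen nodes constant-length walks in D are inserted.\<close>

section \<open>Walks in a flexible component\<close>

text \<open>Identifiers on a path are distinct, so a window cannot share a path with a copy or a
  mirror image of itself; closed walks are therefore led through an auxiliary window with other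
  identifiers. Centre distances 2T+1 and 2T+2 yield closed walks of the consecutive lengths 4T+2 and
  4T+3, whence aperiodicity; this is where n \<ge> 4T+5 comes from. For mending, a stretch of 2r+1
  nodes on each side of v is inspected, unless an end of the path is near. Either it contains an
  unlabelled node, next to which any state of D may be put, or it is fully labelled, so that its
  centre was accepted and has a state in D. Both cases supply a state of D from which a walk can
  start. Short paths keep the original constraints and are relabelled completely; the verifier has
  to recognise them, hence r \<ge> N. The algorithm that is simulated is an optimal one for \<Pi>,
  so the new complexity is bounded in terms of that of \<Pi>. The O(log* n) hypothesis enters as
  T(n) = o(n), which makes the windows fit on the path.\<close>

locale sym_lcl =
  fixes Cedge Cnode :: "('g::finite \<times> 'g) set" and S :: "'g set"
  assumes sym_edge: "sym Cedge" and sym_node: "sym Cnode"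
begin

definition R :: "(('g \<times> 'g) \<times> ('g \<times> 'g)) set" where
  "R = {(x, y). x \<in> Cnode \<and> y \<in> Cnode \<and> (snd x, fst y) \<in> Cedge}"

lemma swap_Cnode: "x \<in> Cnode \<Longrightarrow> prod.swap x \<in> Cnode"
  using sym_node by (cases x) (auto simp: sym_def)

lemma R_swap: "(x, y) \<in> R \<Longrightarrow> (prod.swap y, prod.swap x) \<in> R"
  using sym_edge swap_Cnode unfolding R_def by (auto simp: sym_def)

lemma relpow_swap: "(x, y) \<in> R ^^ k \<Longrightarrow> (prod.swap y, prod.swap x) \<in> R ^^ k"
proof (induction k arbitrary: y)
  case (Suc k)
  then obtain z where "(x, z) \<in> R ^^ k" "(z, y) \<in> R" by auto
  then show ?case using Suc.IH R_swap by (meson relpow_Suc_I2)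
qed auto

lemma rtrancl_swap: "(x, y) \<in> R\<^sup>* \<Longrightarrow> (prod.swap y, prod.swap x) \<in> R\<^sup>*"
  by (meson relpow_swap rtrancl_imp_relpow relpow_imp_rtrancl)

text \<open>An exit towards the other endpoint is not listed: mirroring the entrance gives a walk
  from \<open>prod.swap q\<close> to an endpoint, and the two \<open>swap\<close> conditions connect
  it with \<open>q\<close>.\<close>

definition flexible :: "'g \<times> 'g \<Rightarrow> bool" where
  "flexible q \<longleftrightarrow> q \<in> Cnode \<and> (\<exists>K. \<forall>k\<ge>K. (q, q) \<in> R ^^ k) \<and>
     (q, prod.swap q) \<in> R\<^sup>* \<and> (prod.swap q, q) \<in> R\<^sup>* \<and>
     (\<exists>s\<in>S. \<exists>y\<in>Cnode. (s, fst y) \<in> Cedge \<and> (y, q) \<in> R\<^sup>*)"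

text \<open>Intermediate states are reachable from x and reach y, which later places them in the
  strongly connected component of x and y. That x is in \<open>Cnode\<close> matters for the empty
  walk.\<close>

lemma relpow_between:
  assumes "(x, y) \<in> R ^^ k" "x \<in> Cnode"
  shows "\<exists>p. p 0 = x \<and> p k = y \<and> (\<forall>j<k. (snd (p j), fst (p (Suc j))) \<in> Cedge) \<and>
    (\<forall>j\<le>k. p j \<in> Cnode) \<and> (\<forall>j\<le>k. (x, p j) \<in> R\<^sup>* \<and> (p j, y) \<in> R\<^sup>*)"
proof -
  obtain p where p: "p 0 = x" "p k = y" "\<And>i. i < k \<Longrightarrow> (p i, p (Suc i)) \<in> R"
    using assms(1) unfolding relpow_fun_conv by blast
  have a: "(x, p j) \<in> R\<^sup>* \<and> p j \<in> Cnode" if "j \<le> k" for j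
    using that
  proof (induction j)
    case (Suc j)
    then have "(p j, p (Suc j)) \<in> R" using p(3) by simp
    then show ?case using Suc by (auto simp: R_def intro: rtrancl_into_rtrancl)
  qed (use p assms in auto)
  have b: "(p j, y) \<in> R\<^sup>*" if "j \<le> k" for j
    using that
  proof (induction "k - j" arbitrary: j)
    case (Suc m)
    then have "(p j, p (Suc j)) \<in> R" "(p (Suc j), y) \<in> R\<^sup>*" using p(3) by simp_all
    then show ?case by (meson converse_rtrancl_into_rtrancl)
  qed (use p in auto)
  have "(snd (p j), fst (p (Suc j))) \<in> Cedge" if "j < k" for j
    using p(3)[OF that] by (simp add: R_def)
  then show ?thesis using p(1,2) a b by blast
qed

end

locale flexible_state = sym_lcl Cedge Cnode S
  for Cedge Cnode :: "('g::finite \<times> 'g) set" and S :: "'g set" +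
  fixes q :: "'g \<times> 'g"
  assumes flex: "flexible q"
begin

definition D :: "('g \<times> 'g) set" where
  "D = {x. (q, x) \<in> R\<^sup>* \<and> (x, q) \<in> R\<^sup>*}"

lemma q_D: "q \<in> D" by (auto simp: D_def)

lemma D_Cnode:
  assumes "x \<in> D"
  shows "x \<in> Cnode"
proof -
  have "(q, x) \<in> R\<^sup>*" "q \<in> Cnode" using assms flex by (auto simp: D_def flexible_def)
  then show ?thesis by (cases rule: rtranclE) (auto simp: R_def)
qed

lemma D_swap:
  assumes "x \<in> D"
  shows "prod.swap x \<in> D"
proof -
  have "(prod.swap x, prod.swap q) \<in> R\<^sup>*" "(prod.swap q, prod.swap x) \<in> R\<^sup>*"
    using assms rtrancl_swap unfolding D_def by blast+
  moreover have "(q, prod.swap q) \<in> R\<^sup>*" "(prod.swap q, q) \<in> R\<^sup>*"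
    using flex by (auto simp: flexible_def)
  ultimately show ?thesis unfolding D_def by (blast intro: rtrancl_trans)
qed

text \<open>Go from x to q, spend the surplus on closed walks at q, and go on to y; as there are
  finitely many states, the lengths of the detours have a common bound.\<close>

lemma D_connected: "\<exists>K. \<forall>k\<ge>K. \<forall>x\<in>D. \<forall>y\<in>D. (x, y) \<in> R ^^ k"
proof -
  obtain K where K: "\<And>k. k \<ge> K \<Longrightarrow> (q, q) \<in> R ^^ k"
    using flex unfolding flexible_def by blast
  have "\<forall>x\<in>D. \<exists>a. (x, q) \<in> R ^^ a" "\<forall>x\<in>D. \<exists>a. (q, x) \<in> R ^^ a"
    unfolding D_def using rtrancl_imp_relpow by blast+
  then obtain a b where a: "\<And>x. x \<in> D \<Longrightarrow> (x, q) \<in> R ^^ a x"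
    and b: "\<And>x. x \<in> D \<Longrightarrow> (q, x) \<in> R ^^ b x" by metis
  have "(x, y) \<in> R ^^ k" if k: "k \<ge> Max (range a) + K + Max (range b)" and "x \<in> D" "y \<in> D" for k x y
  proof -
    have "a x \<le> Max (range a)" "b y \<le> Max (range b)" by auto
    then have k': "k = a x + (k - a x - b y) + b y" and "k - a x - b y \<ge> K"
      using k by linarith+
    then have "(q, q) \<in> R ^^ (k - a x - b y)" using K by blast
    then have "(x, y) \<in> R ^^ (a x + (k - a x - b y) + b y)"
      using a[OF \<open>x \<in> D\<close>] b[OF \<open>y \<in> D\<close>] unfolding relpow_add by blast
    then show ?thesis using k' by simp
  qed
  then show ?thesis by blast
qed

text \<open>The two end states are exempt from \<open>Cnode\<close> because they may sit on
  endpoints of the path, where one component is a dummy. The depths \<open>hx\<close> and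
  \<open>hy\<close> say how far from each end \<open>D\<close> need not hold yet.\<close>

definition walk :: "nat \<Rightarrow> 'g \<times> 'g \<Rightarrow> nat \<Rightarrow> 'g \<times> 'g \<Rightarrow> nat \<Rightarrow> (nat \<Rightarrow> 'g \<times> 'g) \<Rightarrow> bool" where
  "walk k x hx y hy p \<longleftrightarrow> p 0 = x \<and> p k = y \<and>
     (\<forall>j<k. (snd (p j), fst (p (Suc j))) \<in> Cedge) \<and> (\<forall>j. 0 < j \<and> j < k \<longrightarrow> p j \<in> Cnode) \<and>
     (\<forall>j. hx \<le> j \<and> j + hy \<le> k \<longrightarrow> p j \<in> D)"

lemma walk_swap:
  assumes "walk k x hx y hy p"
  shows "walk k (prod.swap y) hy (prod.swap x) hx (\<lambda>j. prod.swap (p (k - j)))"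
proof -
  have "(fst (p (k - j)), snd (p (k - Suc j))) \<in> Cedge" if "j < k" for j
  proof -
    have "k - j = Suc (k - Suc j)" using that by simp
    then show ?thesis using assms that sym_edge unfolding walk_def sym_def
      by (metis diff_less zero_less_Suc less_nat_zero_code not_gr_zero)
  qed
  moreover have "prod.swap (p (k - j)) \<in> D" if "hy \<le> j" "j + hx \<le> k" for j
  proof -
    have "hx \<le> k - j" "k - j + hy \<le> k" using that by auto
    then have "p (k - j) \<in> D" using assms unfolding walk_def by blast
    then show ?thesis by (rule D_swap)
  qed
  moreover have "prod.swap (p (k - j)) \<in> Cnode" if "0 < j" "j < k" for j
    using assms that swap_Cnode unfolding walk_def by simp
  moreover have "prod.swap (p (k - 0)) = prod.swap y" "prod.swap (p (k - k)) = prod.swap x"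
    using assms by (auto simp: walk_def)
  ultimately show ?thesis unfolding walk_def fst_swap snd_swap by blast
qed

text \<open>The junction becomes an interior position, so z has to satisfy the node constraint;
  depth 0 on both of its sides keeps the states around it in \<open>D\<close>.\<close>

lemma walk_append:
  assumes "walk k x hx z 0 p" "walk l z 0 y hy p'" "z \<in> D"
  shows "walk (k + l) x hx y hy (\<lambda>j. if j \<le> k then p j else p' (j - k))"
proof -
  let ?P = "\<lambda>j. if j \<le> k then p j else p' (j - k)"
  have "(snd (?P j), fst (?P (Suc j))) \<in> Cedge" if "j < k + l" for j
  proof (cases "j < k")
    case False
    then have *: "?P j = p' (j - k)" "?P (Suc j) = p' (Suc (j - k))" "j - k < l"
      using assms(1,2) that by (auto simp: walk_def Suc_diff_le)
    show ?thesis unfolding * using assms(2) *(3) by (auto simp: walk_def)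
  qed (use assms in \<open>auto simp: walk_def\<close>)
  moreover have "?P j \<in> Cnode" if "0 < j" "j < k + l" for j
    using assms that D_Cnode[of z] by (cases j k rule: linorder_cases) (auto simp: walk_def)
  moreover have "?P j \<in> D" if "hx \<le> j" "j + hy \<le> k + l" for j
  proof (cases "j \<le> k")
    case True
    then show ?thesis using assms(1) that unfolding walk_def by simp
  next
    case False
    then have "0 \<le> j - k" "j - k + hy \<le> l" using that by simp_all
    then show ?thesis using assms(2) False unfolding walk_def by simp
  qed
  moreover have "?P 0 = x" "?P (k + l) = y" using assms(1,2) by (auto simp: walk_def)
  ultimately show ?thesis unfolding walk_def by blast
qed

lemma relpow_walk:
  assumes "(x, y) \<in> R ^^ k" "x \<in> D" "y \<in> D"
  shows "\<exists>p. walk k x 0 y 0 p"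
proof -
  obtain p where p: "p 0 = x" "p k = y" "\<forall>j<k. (snd (p j), fst (p (Suc j))) \<in> Cedge"
    "\<forall>j\<le>k. p j \<in> Cnode" "\<forall>j\<le>k. (x, p j) \<in> R\<^sup>* \<and> (p j, y) \<in> R\<^sup>*"
    using relpow_between[OF assms(1) D_Cnode[OF assms(2)]] by blast
  have "p j \<in> D" if "j \<le> k" for j
    using assms(2,3) that p(5) unfolding D_def by (blast intro: rtrancl_trans)
  then have "walk k x 0 y 0 p" using p(1-4) unfolding walk_def by simp
  then show ?thesis by blast
qed

text \<open>Endpoints of the path are labelled (s, s), so that their state does not depend on the direction
  of traversal; the component is entered h steps later.\<close>

definition terminal :: "'g \<Rightarrow> nat \<Rightarrow> 'g \<times> 'g \<Rightarrow> nat \<Rightarrow> bool" where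
  "terminal s h x hx \<longleftrightarrow> x \<in> D \<and> hx = 0 \<or> x = (s, s) \<and> hx = h"

text \<open>The entrance contained in \<open>flexible\<close> is prefixed with the dummy state
  \<open>(s, s)\<close>. As the depth equals the length, only the last state has to lie in
  \<open>D\<close>.\<close>

lemma ex_start_walk: "\<exists>s\<in>S. \<exists>h>0. \<exists>p. walk h (s, s) h q 0 p"
proof -
  obtain s y k where s: "s \<in> S" "y \<in> Cnode" "(s, fst y) \<in> Cedge" "(y, q) \<in> R ^^ k"
    using flex unfolding flexible_def by (meson rtrancl_imp_relpow)
  obtain p where p: "p 0 = y" "p k = q" "\<forall>j<k. (snd (p j), fst (p (Suc j))) \<in> Cedge"
    "\<forall>j\<le>k. p j \<in> Cnode"
    using relpow_between[OF s(4,2)] by blast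
  have "(snd (case_nat (s, s) p j), fst (case_nat (s, s) p (Suc j))) \<in> Cedge" if "j < Suc k" for j
    using that p s by (cases j) auto
  moreover have "case_nat (s, s) p j \<in> Cnode" if "0 < j" "j < Suc k" for j
    using that p(4) by (cases j) auto
  moreover have "case_nat (s, s) p j \<in> D" if "Suc k \<le> j" "j \<le> Suc k" for j
    using that p(2) q_D by (cases j) auto
  ultimately have "walk (Suc k) (s, s) (Suc k) q 0 (case_nat (s, s) p)"
    using p(2) unfolding walk_def add_0_right nat.case by blast
  then show ?thesis using s(1) by blast
qed

lemma walks_between_terminals:
  "\<exists>s\<in>S. \<exists>h>0. \<exists>K. \<forall>k\<ge>K. \<forall>x hx y hy. terminal s h x hx \<longrightarrow> terminal s h y hy \<longrightarrow>
     (\<exists>p. walk k x hx y hy p)"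
proof -
  obtain s h p where s: "s \<in> S" "h > 0" "walk h (s, s) h q 0 p" using ex_start_walk by blast
  obtain K where K: "\<And>k x y. k \<ge> K \<Longrightarrow> x \<in> D \<Longrightarrow> y \<in> D \<Longrightarrow> (x, y) \<in> R ^^ k"
    using D_connected by blast
  \<comment> \<open>An exit is a mirrored entrance: it takes h steps and departs from
    \<open>prod.swap q\<close>, which lies in \<open>D\<close> as well.\<close>
  have from_D: "\<exists>p. walk k x 0 y hy p" if kx: "k \<ge> K + h" "x \<in> D" and "terminal s h y hy" for k x y hy
  proof (cases "y \<in> D \<and> hy = 0")
    case False
    then have y: "y = (s, s)" "hy = h" using that(3) by (auto simp: terminal_def)
    obtain p1 where p1: "walk (k - h) x 0 (prod.swap q) 0 p1"
      using relpow_walk[OF K[of "k - h" x "prod.swap q"] kx(2) D_swap[OF q_D]]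
        kx D_swap[OF q_D] by (auto simp: le_diff_conv2)
    have "k - h + h = k" using that(1) by simp
    then show ?thesis using walk_append[OF p1 walk_swap[OF s(3)] D_swap[OF q_D]] y by auto
  next
    case True
    then show ?thesis using relpow_walk[OF K[of k x y]] that(1,2) by simp
  qed
  have "\<exists>p. walk k x hx y hy p" if k: "k \<ge> K + h + h" and "terminal s h x hx" "terminal s h y hy"
    for k x hx y hy
  proof (cases "x \<in> D \<and> hx = 0")
    case False
    then have x: "x = (s, s)" "hx = h" using that(2) by (auto simp: terminal_def)
    obtain p1 where p1: "walk (k - h) q 0 y hy p1"
      using from_D[of "k - h" q y hy] k \<open>terminal s h y hy\<close> q_D by (auto simp: le_diff_conv2)
    have "h + (k - h) = k" using k by simp
    then show ?thesis using walk_append[OF s(3) p1 q_D] x by auto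
  next
    case True
    then show ?thesis using from_D[of k x y hy] k \<open>terminal s h y hy\<close> by simp
  qed
  then show ?thesis using s by blast
qed

end

section \<open>The restricted problem\<close>

context flexible_state
begin

text \<open>A view with centre k shows an end of the path if it is shorter than r on that side. Since N will
  not exceed r, a view has at least N edges iff the path has more than N nodes.\<close>

definition verifier :: "nat \<Rightarrow> nat \<Rightarrow> nat \<Rightarrow> ('g \<times> 'g) list \<Rightarrow> nat \<Rightarrow> bool" where
  "verifier r h N es k \<longleftrightarrow> (\<forall>e\<in>set es. e \<in> Cedge) \<and>
     (\<forall>j. Suc j < length es \<longrightarrow> (snd (es ! j), fst (es ! Suc j)) \<in> Cnode) \<and>
     (k < r \<and> es \<noteq> [] \<longrightarrow> fst (hd es) \<in> S) \<and>
     (length es - k < r \<and> es \<noteq> [] \<longrightarrow> snd (last es) \<in> S) \<and>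
     (h \<le> k \<and> k + h \<le> length es \<and> N \<le> length es \<longrightarrow> (snd (es ! (k - 1)), fst (es ! k)) \<in> D)"

text \<open>Paths with at most N nodes keep exactly the constraints of \<Pi>: they may be too short
  for a walk between the two ends through \<open>D\<close>, and finitely many sizes do not affect
  the asymptotics.\<close>

definition restricted :: "nat \<Rightarrow> nat \<Rightarrow> nat \<Rightarrow> (nat \<Rightarrow> 'g \<times> 'g) \<Rightarrow> bool" where
  "restricted h N n L \<longleftrightarrow> necl_solution Cedge Cnode S S n L \<and>
     (N < n \<longrightarrow> (\<forall>i. h \<le> i \<and> i + h < n \<longrightarrow> L i \<in> D))"

lemma orientation_invariant_verifier:
  assumes "0 < h"
  shows "orientation_invariant (verifier r h N)"
proof -
  \<comment> \<open>Mirroring a view twice restores it, so this one implication yields the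
    equivalence.\<close>
  have imp: "verifier r h N (rev (map prod.swap es)) (length es - k)"
    if k: "k \<le> length es" and v: "verifier r h N es k" for es k
  proof -
    let ?es = "rev (map prod.swap es)"
    have nth: "?es ! j = prod.swap (es ! (length es - Suc j))" if "j < length es" for j
      using that by (simp add: rev_nth)
    have "(snd (?es ! j), fst (?es ! Suc j)) \<in> Cnode" if j: "Suc j < length es" for j
    proof -
      have "(snd (es ! (length es - Suc (Suc j))), fst (es ! Suc (length es - Suc (Suc j)))) \<in> Cnode"
        using v j unfolding verifier_def by simp
      then have "prod.swap (snd (es ! (length es - Suc (Suc j))), fst (es ! (length es - Suc j))) \<in> Cnode"
        using j swap_Cnode by (simp add: Suc_diff_Suc del: swap_simp)
      then show ?thesis using j by (simp add: nth)
    qed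
    moreover have "(snd (?es ! (length es - k - 1)), fst (?es ! (length es - k))) \<in> D"
      if j: "h \<le> length es - k" "length es - k + h \<le> length es" "N \<le> length es"
    proof -
      \<comment> \<open>Because h is positive, the centre is strictly inside the view and both of
        its half-edges are visible.\<close>
      have k': "0 < k" "k < length es" using j assms k by auto
      have "prod.swap (snd (es ! (k - 1)), fst (es ! k)) \<in> D"
        by (rule D_swap) (use v j k in \<open>auto simp: verifier_def\<close>)
      then show ?thesis using k' by (simp add: nth Suc_diff_Suc)
    qed
    moreover have "\<forall>e\<in>set ?es. e \<in> Cedge"
      using v sym_edge by (auto simp: verifier_def sym_def)
    moreover have "fst (hd ?es) \<in> S" if "length es - k < r" "?es \<noteq> []"
      using v that by (simp add: verifier_def hd_rev last_map)
    moreover have "snd (last ?es) \<in> S" if "k < r" "?es \<noteq> []"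
      using v that by (simp add: verifier_def last_rev hd_map)
    ultimately show ?thesis using k unfolding verifier_def by simp
  qed
  show ?thesis unfolding orientation_invariant_def
  proof (intro allI impI iffI)
    fix es :: "('g \<times> 'g) list" and k
    assume k: "k \<le> length es"
      and "verifier r h N (rev (map prod.swap es)) (length es - k)"
    from imp[OF _ this(2)] show "verifier r h N es k"
      using k by (simp add: rev_map comp_def)
  qed (use imp in simp)
qed

text \<open>In absolute positions the constraints seen from different centres can be compared. A
  node constraint is seen only strictly inside the view, where both incident edges are visible, so
  one of its bounds is strict where the edge constraint has \<le>.\<close>

lemma happy_iff:
  assumes r: "0 < h" "h \<le> r" "N \<le> r" and z: "z < n"
  shows "lcl_happy r (verifier r h N) n L z \<longleftrightarrow>
    (\<forall>j. z \<le> j + r \<and> j < z + r \<and> Suc j < n \<longrightarrow> (snd (L j), fst (L (Suc j))) \<in> Cedge) \<and>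
    (\<forall>j. 0 < j \<and> z < j + r \<and> j < z + r \<and> Suc j < n \<longrightarrow> L j \<in> Cnode) \<and>
    (z < r \<and> 2 \<le> n \<longrightarrow> snd (L 0) \<in> S) \<and> (n - 1 < z + r \<and> 2 \<le> n \<longrightarrow> fst (L (n - 1)) \<in> S) \<and>
    (h \<le> z \<and> z + h < n \<and> N < n \<longrightarrow> L z \<in> D)"
proof -
  let ?a = "z - r" and ?b = "min (n - 1) (z + r)"
  let ?es = "nbhd_edges r n L z" and ?k = "nbhd_center r z"
  have len: "length ?es = ?b - ?a" by (simp add: nbhd_edges_def)
  have ab: "?a \<le> z" "z \<le> ?b" using z by auto
  have nth: "?es ! j = (snd (L (?a + j)), fst (L (Suc (?a + j))))" if "j < ?b - ?a" for j
  proof -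
    have "?a + j < ?b" using that by linarith
    then have "[?a..<?b] ! j = ?a + j" by (rule nth_upt)
    then show ?thesis using that unfolding nbhd_edges_def by (subst nth_map) auto
  qed
  have k: "?k = z - ?a" by (simp add: nbhd_center_def)
  have ne: "?es \<noteq> [] \<longleftrightarrow> 2 \<le> n" using z r by (auto simp: nbhd_edges_def)
  have 1: "(\<forall>e\<in>set ?es. e \<in> Cedge) \<longleftrightarrow>
    (\<forall>j. z \<le> j + r \<and> j < z + r \<and> Suc j < n \<longrightarrow> (snd (L j), fst (L (Suc j))) \<in> Cedge)"
  proof -
    have "j \<in> set [?a..<?b] \<longleftrightarrow> z \<le> j + r \<and> j < z + r \<and> Suc j < n" for j by auto
    then show ?thesis unfolding nbhd_edges_def set_map by blast
  qed
  have 2: "(\<forall>j. Suc j < length ?es \<longrightarrow> (snd (?es ! j), fst (?es ! Suc j)) \<in> Cnode) \<longleftrightarrow>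
    (\<forall>j. 0 < j \<and> z < j + r \<and> j < z + r \<and> Suc j < n \<longrightarrow> L j \<in> Cnode)" (is "?l \<longleftrightarrow> ?r")
  proof
    assume l: ?l
    show ?r
    proof (intro allI impI)
      fix j assume j: "0 < j \<and> z < j + r \<and> j < z + r \<and> Suc j < n"
      then have i: "Suc (j - 1 - ?a) < length ?es" "?a + (j - 1 - ?a) = j - 1" "?a + Suc (j - 1 - ?a) = j"
        unfolding len by auto
      show "L j \<in> Cnode" using l[rule_format, OF i(1)] i j unfolding len by (simp add: nth)
    qed
  next
    assume r: ?r
    show ?l
    proof (intro allI impI)
      fix j assume "Suc j < length ?es"
      then have j: "Suc j < ?b - ?a" by (simp only: len)
      moreover have "?b \<le> n - 1" "?b \<le> z + r" "z \<le> ?a + r" by auto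
      ultimately have "0 < Suc (?a + j)" "z < Suc (?a + j) + r" "Suc (?a + j) < z + r" "Suc (Suc (?a + j)) < n"
        by linarith+
      then have "L (Suc (?a + j)) \<in> Cnode" using r[rule_format, of "Suc (?a + j)"] by blast
      then show "(snd (?es ! j), fst (?es ! Suc j)) \<in> Cnode" using j by (simp add: nth)
    qed
  qed
  have 3: "(?k < r \<and> ?es \<noteq> [] \<longrightarrow> fst (hd ?es) \<in> S) \<longleftrightarrow> (z < r \<and> 2 \<le> n \<longrightarrow> snd (L 0) \<in> S)"
  proof -
    have "fst (hd ?es) = snd (L 0)" if "z < r" "2 \<le> n"
      using that ne nth[of 0] z by (simp add: hd_conv_nth)
    moreover have "?k < r \<longleftrightarrow> z < r" unfolding k using r by auto
    ultimately show ?thesis using ne by auto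
  qed
  have 4: "(length ?es - ?k < r \<and> ?es \<noteq> [] \<longrightarrow> snd (last ?es) \<in> S) \<longleftrightarrow>
      (n - 1 < z + r \<and> 2 \<le> n \<longrightarrow> fst (L (n - 1)) \<in> S)"
  proof -
    have "snd (last ?es) = fst (L (n - 1))" if "n - 1 < z + r" "2 \<le> n"
    proof -
      have j: "?b - ?a - 1 < ?b - ?a" "Suc (?a + (?b - ?a - 1)) = n - 1" using that z r by auto
      show ?thesis using ne that nth[OF j(1)] by (simp only: last_conv_nth len j(2) snd_conv)
    qed
    moreover have "length ?es - ?k < r \<longleftrightarrow> n - 1 < z + r" unfolding k len using ab r by auto
    ultimately show ?thesis using ne by auto
  qed
  have 5: "(h \<le> ?k \<and> ?k + h \<le> length ?es \<and> N \<le> length ?es \<longrightarrow> (snd (?es ! (?k - 1)), fst (?es ! ?k)) \<in> D)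
    \<longleftrightarrow> (h \<le> z \<and> z + h < n \<and> N < n \<longrightarrow> L z \<in> D)"
  proof -
    have "h \<le> ?k \<longleftrightarrow> h \<le> z" unfolding k using r by (cases "z \<le> r") auto
    moreover have "?k + h \<le> length ?es \<longleftrightarrow> z + h < n"
    proof -
      have "?k + h \<le> length ?es \<longleftrightarrow> z + h \<le> ?b" unfolding k len using ab by linarith
      also have "\<dots> \<longleftrightarrow> z + h < n" using r z by (cases "z + r \<le> n - 1") auto
      finally show ?thesis .
    qed
    \<comment> \<open>If the view is cut off by the radius on some side, it has at least r \<ge> N
      edges, and so has the path; otherwise it is the whole path with n - 1 edges.\<close>
    moreover have "N \<le> length ?es \<longleftrightarrow> N < n"
      unfolding len using r z by (cases "z \<le> r"; cases "z + r \<le> n - 1") auto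
    ultimately have "h \<le> ?k \<and> ?k + h \<le> length ?es \<and> N \<le> length ?es \<longleftrightarrow>
        h \<le> z \<and> z + h < n \<and> N < n" by blast
    moreover have "(snd (?es ! (?k - 1)), fst (?es ! ?k)) = L z" if "h \<le> z" "z + h < n"
    proof -
      have j: "?k - 1 < ?b - ?a" "?k < ?b - ?a" "Suc (?a + (?k - 1)) = z" "?a + ?k = z"
        unfolding k using r that by auto
      show ?thesis using j by (simp add: nth)
    qed
    ultimately show ?thesis by metis
  qed
  show ?thesis unfolding lcl_happy_def verifier_def 1 2 3 4 5 ..
qed

lemma lcl_solution_verifier:
  assumes r: "0 < h" "h \<le> r" "N \<le> r"
  shows "lcl_solution r (verifier r h N) n L \<longleftrightarrow> restricted h N n L"
proof
  assume l: "lcl_solution r (verifier r h N) n L"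
  then have H: "lcl_happy r (verifier r h N) n L z" if "z < n" for z
    using that by (auto simp: lcl_solution_def)
  have r0: "0 < r" using r by simp
  show "restricted h N n L" unfolding restricted_def necl_solution_def
  proof (intro conjI allI impI)
    fix j assume "Suc j < n"
    then show "(snd (L j), fst (L (Suc j))) \<in> Cedge" using H[of j] happy_iff[OF r, of j n L] r0 by auto
  next
    fix j assume "0 < j \<and> Suc j < n"
    then show "(fst (L j), snd (L j)) \<in> Cnode" using H[of j] happy_iff[OF r, of j n L] r0 by auto
  next
    assume "2 \<le> n"
    then show "snd (L 0) \<in> S" "fst (L (n - 1)) \<in> S"
      using H[of 0] H[of "n - 1"] happy_iff[OF r, of 0 n L] happy_iff[OF r, of "n - 1" n L] r0 by auto
  next
    fix j assume "h \<le> j \<and> j + h < n" "N < n"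
    then show "L j \<in> D" using H[of j] happy_iff[OF r, of j n L] by auto
  qed
next
  assume *: "restricted h N n L"
  show "lcl_solution r (verifier r h N) n L" unfolding lcl_solution_def
  proof (intro allI impI)
    fix z assume "z < n"
    then show "lcl_happy r (verifier r h N) n L z"
      using * unfolding happy_iff[OF r \<open>z < n\<close>] by (simp add: restricted_def necl_solution_def)
  qed
qed

end

section \<open>Mending\<close>

locale terminal_walks = flexible_state Cedge Cnode S q
  for Cedge Cnode :: "('g::finite \<times> 'g) set" and S :: "'g set" and q :: "'g \<times> 'g" +
  fixes s :: 'g and h K :: nat
  assumes s_S: "s \<in> S" and h_pos: "0 < h"
    and ex_walk: "K \<le> k \<Longrightarrow> terminal s h x hx \<Longrightarrow> terminal s h y hy \<Longrightarrow> \<exists>p. walk k x hx y hy p"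
begin

lemma path_dist_le: "path_dist u v \<le> r \<longleftrightarrow> u \<le> v + r \<and> v \<le> u + r"
  by (auto simp: path_dist_def)

lemma happyD:
  assumes "h \<le> r" "N \<le> r" "N < n" "0 < N" "lcl_happy r (verifier r h N) n L z" "z < n"
  shows "z \<le> j + r \<Longrightarrow> j < z + r \<Longrightarrow> Suc j < n \<Longrightarrow> (snd (L j), fst (L (Suc j))) \<in> Cedge"
    and "0 < j \<Longrightarrow> z < j + r \<Longrightarrow> j < z + r \<Longrightarrow> Suc j < n \<Longrightarrow> L j \<in> Cnode"
    and "z < r \<Longrightarrow> snd (L 0) \<in> S" and "n - 1 < z + r \<Longrightarrow> fst (L (n - 1)) \<in> S"
    and "h \<le> z \<Longrightarrow> z + h < n \<Longrightarrow> L z \<in> D"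
  using assms(5) h_pos assms(3,4) unfolding happy_iff[OF h_pos assms(1,2,6)] by auto

text \<open>The part of the path to the left of the node v that is to be mended is left unchanged before
  position A, where A is the end of the path, the right neighbour of an unlabelled node, or a node
  whose whole neighbourhood has been accepted.\<close>

lemma left_boundary:
  assumes r: "h \<le> r" "N \<le> r" "N < n" "0 < N" and v: "v < n"
    and lam: "relaxed_accepted r (verifier r h N) n lam"
  shows "\<exists>A x hx. A \<le> v \<and> v \<le> A + (K + 2 * r + 1) \<and> (A = 0 \<or> A + K \<le> v) \<and>
    (if A = 0 then x = (s, s) \<and> hx = h else x \<in> D \<and> hx = 0) \<and>
    (\<forall>mu. (\<forall>u<A. mu u = lam u) \<longrightarrow> mu A = Some x \<longrightarrow>
      (\<forall>z<n. (\<forall>u<n. u \<le> z + r \<and> z \<le> u + r \<longrightarrow> mu u \<noteq> None) \<longrightarrow>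
        (\<forall>j<A. z \<le> j + r \<and> j < z + r \<longrightarrow> (snd (the (mu j)), fst (the (mu (Suc j)))) \<in> Cedge) \<and>
        (\<forall>j<A. 0 < j \<and> z < j + r \<and> j < z + r \<longrightarrow> the (mu j) \<in> Cnode) \<and>
        (z < r \<longrightarrow> snd (the (mu 0)) \<in> S) \<and>
        (h \<le> z \<and> z + h < n \<and> z < A \<longrightarrow> the (mu z) \<in> D)))"
proof -
  note hD = happyD[OF r]
  have happy: "lcl_happy r (verifier r h N) n (\<lambda>u. the (lam u)) z"
    if "z < n" "\<And>u. u < n \<Longrightarrow> u \<le> z + r \<Longrightarrow> z \<le> u + r \<Longrightarrow> lam u \<noteq> None" for z
    using lam that unfolding relaxed_accepted_def relaxed_happy_def path_dist_le by blast
  \<comment> \<open>The stretch from v - K - 2r - 1 to v - K - 1 has 2r + 1 nodes, a full ball of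
    radius r, and leaves at least K steps up to v.\<close>
  consider "v < K + 2 * r + 1"
    | u where "v \<le> u + K + 2 * r + 1" "u + K + 1 \<le> v" "lam u = None"
    | "K + 2 * r + 1 \<le> v" "\<And>u. v \<le> u + K + 2 * r + 1 \<Longrightarrow> u + K + 1 \<le> v \<Longrightarrow> lam u \<noteq> None"
    by (meson not_le)
  then show ?thesis
  proof cases
    case 1
    then show ?thesis using s_S by (intro exI[of _ 0] exI[of _ "(s, s)"] exI[of _ h]) auto
  next
    case (2 u)
    have "(\<forall>j<Suc u. z \<le> j + r \<and> j < z + r \<longrightarrow> (snd (the (mu j)), fst (the (mu (Suc j)))) \<in> Cedge) \<and>
        (\<forall>j<Suc u. 0 < j \<and> z < j + r \<and> j < z + r \<longrightarrow> the (mu j) \<in> Cnode) \<and>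
        (z < r \<longrightarrow> snd (the (mu 0)) \<in> S) \<and>
        (h \<le> z \<and> z + h < n \<and> z < Suc u \<longrightarrow> the (mu z) \<in> D)"
      if mu: "\<forall>u'<Suc u. mu u' = lam u'" and z: "z < n"
        and free: "\<forall>u<n. u \<le> z + r \<and> z \<le> u + r \<longrightarrow> mu u \<noteq> None" for mu z
    proof -
      have "u < n" using 2 v by simp
      moreover have "mu u = None" using 2 mu by simp
      \<comment> \<open>A node that sees u is excused, so z has its view entirely on one side of u:
        on the left nothing was changed, and on the right no constraint before A is visible.\<close>
      ultimately have "z + r < u \<or> u + r < z" using free by (meson not_le)
      then show ?thesis
      proof
        assume zu: "z + r < u"
        have "lcl_happy r (verifier r h N) n (\<lambda>u. the (lam u)) z"
        proof (rule happy[OF z])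
          fix u' assume "u' < n" "u' \<le> z + r" "z \<le> u' + r"
          then show "lam u' \<noteq> None" using free mu zu by (metis less_Suc_eq le_less_trans less_trans)
        qed
        note hz = hD[OF this z]
        have "mu 0 = lam 0" "mu z = lam z" using mu zu by auto
        moreover have "mu j = lam j" "mu (Suc j) = lam (Suc j)" "Suc j < n" if "j < z + r" for j
          using mu zu that \<open>u < n\<close> by auto
        ultimately show ?thesis using hz by simp
      qed auto
    qed
    then show ?thesis using 2 q_D by (intro exI[of _ "Suc u"] exI[of _ q] exI[of _ 0]) auto
  next
    case 3
    define A where "A = v - K - 1 - r"
    have A: "A + K + r + 1 = v" "r \<le> A" "0 < A" using 3(1) r unfolding A_def by auto
    have free_A: "lam u \<noteq> None" if "u \<le> A + r" "A \<le> u + r" for u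
      using 3(2)[of u] that A by simp
    obtain x where x: "lam A = Some x" using free_A[of A] by auto
    have hA: "lcl_happy r (verifier r h N) n (\<lambda>u. the (lam u)) A"
      using happy[of A] free_A A v by simp
    have "x \<in> D" using hD(5)[OF hA] A v r x by simp
    moreover have "(\<forall>j<A. z \<le> j + r \<and> j < z + r \<longrightarrow> (snd (the (mu j)), fst (the (mu (Suc j)))) \<in> Cedge) \<and>
        (\<forall>j<A. 0 < j \<and> z < j + r \<and> j < z + r \<longrightarrow> the (mu j) \<in> Cnode) \<and>
        (z < r \<longrightarrow> snd (the (mu 0)) \<in> S) \<and>
        (h \<le> z \<and> z + h < n \<and> z < A \<longrightarrow> the (mu z) \<in> D)"
      if mu: "\<forall>u<A. mu u = lam u" "mu A = Some x" and z: "z < n"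
        and free: "\<forall>u<n. u \<le> z + r \<and> z \<le> u + r \<longrightarrow> mu u \<noteq> None" for mu z
    proof -
      have eq: "mu j = lam j" if "j \<le> A" for j using mu x that by (cases "j = A") auto
      \<comment> \<open>To the left of A, a node beyond A sees nothing that A does not see. The old
        acceptance of A thus certifies these constraints even if z itself sees new labels.\<close>
      define z' where "z' = min z A"
      have z': "z' < n" "z' \<le> z" using z by (auto simp: z'_def)
      have "lcl_happy r (verifier r h N) n (\<lambda>u. the (lam u)) z'"
      proof (cases "z \<le> A")
        case True
        then have "lcl_happy r (verifier r h N) n (\<lambda>u. the (lam u)) z"
        proof (intro happy[OF z])
          fix u assume "u < n" "u \<le> z + r" "z \<le> u + r" "z \<le> A"
          moreover from this have "mu u \<noteq> None" using free by blast
          ultimately show "lam u \<noteq> None" using eq[of u] free_A[of u] by (metis le_trans nat_le_linear add_le_mono1)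
        qed
        then show ?thesis using True by (simp add: z'_def)
      qed (use hA in \<open>simp add: z'_def\<close>)
      note hz = hD[OF this z'(1)]
      have "(snd (the (mu j)), fst (the (mu (Suc j)))) \<in> Cedge" if "j < A" "z \<le> j + r" "j < z + r" for j
        using hz(1)[of j] that z' A v r eq[of j] eq[of "Suc j"] unfolding z'_def by (simp add: min_def split: if_splits)
      moreover have "the (mu j) \<in> Cnode" if "j < A" "0 < j" "z < j + r" "j < z + r" for j
        using hz(2)[of j] that z' A v r eq[of j] unfolding z'_def by (simp add: min_def split: if_splits)
      moreover have "snd (the (mu 0)) \<in> S" if "z < r"
        using hz(3) that z' eq[of 0] by simp
      moreover have "the (mu z) \<in> D" if "h \<le> z" "z + h < n" "z < A"
        using hz(5) that eq[of z] unfolding z'_def by simp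
      ultimately show ?thesis by blast
    qed
    ultimately show ?thesis using A by (intro exI[of _ A] exI[of _ x] exI[of _ 0]) simp
  qed
qed

text \<open>The mirror image of \<open>left_boundary\<close>: B is the last node, the left neighbour
  of an unlabelled node, or the centre of a fully labelled ball.\<close>

lemma right_boundary:
  assumes r: "h \<le> r" "N \<le> r" "N < n" "0 < N" and v: "v < n"
    and lam: "relaxed_accepted r (verifier r h N) n lam"
  shows "\<exists>B y hy. v \<le> B \<and> B < n \<and> B \<le> v + (K + 2 * r + 1) \<and> (B = n - 1 \<or> v + K \<le> B) \<and>
    (if B = n - 1 then y = (s, s) \<and> hy = h else y \<in> D \<and> hy = 0) \<and>
    (\<forall>mu. (\<forall>u<n. B < u \<longrightarrow> mu u = lam u) \<longrightarrow> mu B = Some y \<longrightarrow>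
      (\<forall>z<n. (\<forall>u<n. u \<le> z + r \<and> z \<le> u + r \<longrightarrow> mu u \<noteq> None) \<longrightarrow>
        (\<forall>j\<ge>B. Suc j < n \<and> z \<le> j + r \<and> j < z + r \<longrightarrow> (snd (the (mu j)), fst (the (mu (Suc j)))) \<in> Cedge) \<and>
        (\<forall>j>B. Suc j < n \<and> z < j + r \<and> j < z + r \<longrightarrow> the (mu j) \<in> Cnode) \<and>
        (n - 1 < z + r \<longrightarrow> fst (the (mu (n - 1))) \<in> S) \<and>
        (h \<le> z \<and> z + h < n \<and> B < z \<longrightarrow> the (mu z) \<in> D)))"
proof -
  note hD = happyD[OF r]
  have happy: "lcl_happy r (verifier r h N) n (\<lambda>u. the (lam u)) z"
    if "z < n" "\<And>u. u < n \<Longrightarrow> u \<le> z + r \<Longrightarrow> z \<le> u + r \<Longrightarrow> lam u \<noteq> None" for z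
    using lam that unfolding relaxed_accepted_def relaxed_happy_def path_dist_le by blast
  consider "n \<le> v + K + 2 * r + 1"
    | u where "u < n" "u \<le> v + K + 2 * r + 1" "v + K + 1 \<le> u" "lam u = None"
    | "v + K + 2 * r + 1 < n" "\<And>u. u \<le> v + K + 2 * r + 1 \<Longrightarrow> v + K + 1 \<le> u \<Longrightarrow> lam u \<noteq> None"
    by (meson le_less_trans not_le)
  then show ?thesis
  proof cases
    case 1
    then show ?thesis using s_S v by (intro exI[of _ "n - 1"] exI[of _ "(s, s)"] exI[of _ h]) auto
  next
    case (2 u)
    obtain B where B: "u = Suc B" using 2 by (cases u) auto
    have "(\<forall>j\<ge>B. Suc j < n \<and> z \<le> j + r \<and> j < z + r \<longrightarrow> (snd (the (mu j)), fst (the (mu (Suc j)))) \<in> Cedge) \<and>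
        (\<forall>j>B. Suc j < n \<and> z < j + r \<and> j < z + r \<longrightarrow> the (mu j) \<in> Cnode) \<and>
        (n - 1 < z + r \<longrightarrow> fst (the (mu (n - 1))) \<in> S) \<and>
        (h \<le> z \<and> z + h < n \<and> B < z \<longrightarrow> the (mu z) \<in> D)"
      if mu: "\<forall>u'<n. B < u' \<longrightarrow> mu u' = lam u'" and z: "z < n"
        and free: "\<forall>u<n. u \<le> z + r \<and> z \<le> u + r \<longrightarrow> mu u \<noteq> None" for mu z
    proof -
      have "mu u = None" using 2 mu B by simp
      then have "z + r < u \<or> u + r < z" using free 2(1) by (meson not_le)
      then show ?thesis
      proof
        assume zu: "u + r < z"
        have eq: "mu j = lam j" if "u \<le> j" "j < n" for j using mu B that by simp
        have "lcl_happy r (verifier r h N) n (\<lambda>u. the (lam u)) z"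
        proof (rule happy[OF z])
          fix u' assume "u' < n" "u' \<le> z + r" "z \<le> u' + r"
          moreover from this have "mu u' \<noteq> None" using free by blast
          ultimately show "lam u' \<noteq> None" using eq[of u'] zu by simp
        qed
        note hz = hD[OF this z]
        have "mu z = lam z" "mu (n - 1) = lam (n - 1)" using eq zu z 2(1) by auto
        moreover have "mu j = lam j" "Suc j < n \<Longrightarrow> mu (Suc j) = lam (Suc j)" if "z \<le> j + r" "j < n" for j
          using eq zu that by auto
        ultimately show ?thesis using hz by simp
      qed (use 2(1) B in auto)
    qed
    then show ?thesis using 2 B q_D by (intro exI[of _ B] exI[of _ q] exI[of _ 0]) auto
  next
    case 3
    define B where "B = v + K + 1 + r"
    have B: "B + r < n" "r \<le> B" "0 < B" using 3(1) r unfolding B_def by auto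
    have free_B: "lam u \<noteq> None" if "u \<le> B + r" "B \<le> u + r" for u
      using 3(2)[of u] that by (simp add: B_def)
    obtain y where y: "lam B = Some y" using free_B[of B] by auto
    have hB: "lcl_happy r (verifier r h N) n (\<lambda>u. the (lam u)) B"
      using happy[of B] free_B B v by simp
    have "y \<in> D" using hD(5)[OF hB] B v r y by simp
    moreover have "(\<forall>j\<ge>B. Suc j < n \<and> z \<le> j + r \<and> j < z + r \<longrightarrow> (snd (the (mu j)), fst (the (mu (Suc j)))) \<in> Cedge) \<and>
        (\<forall>j>B. Suc j < n \<and> z < j + r \<and> j < z + r \<longrightarrow> the (mu j) \<in> Cnode) \<and>
        (n - 1 < z + r \<longrightarrow> fst (the (mu (n - 1))) \<in> S) \<and>
        (h \<le> z \<and> z + h < n \<and> B < z \<longrightarrow> the (mu z) \<in> D)"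
      if mu: "\<forall>u<n. B < u \<longrightarrow> mu u = lam u" "mu B = Some y" and z: "z < n"
        and free: "\<forall>u<n. u \<le> z + r \<and> z \<le> u + r \<longrightarrow> mu u \<noteq> None" for mu z
    proof -
      have eq: "mu j = lam j" if "B \<le> j" "j < n" for j using mu y that by (cases "j = B") auto
      define z' where "z' = max z B"
      have z': "z' < n" "z \<le> z'" using z B by (auto simp: z'_def)
      have "lcl_happy r (verifier r h N) n (\<lambda>u. the (lam u)) z'"
      proof (cases "B \<le> z")
        case True
        then have "lcl_happy r (verifier r h N) n (\<lambda>u. the (lam u)) z"
        proof (intro happy[OF z])
          fix u assume "u < n" "u \<le> z + r" "z \<le> u + r" "B \<le> z"
          moreover from this have "mu u \<noteq> None" using free by blast
          ultimately show "lam u \<noteq> None" using eq[of u] free_B[of u] by (metis le_trans nat_le_linear trans_le_add1)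
        qed
        then show ?thesis using True by (simp add: z'_def)
      qed (use hB in \<open>simp add: z'_def\<close>)
      note hz = hD[OF this z'(1)]
      have "(snd (the (mu j)), fst (the (mu (Suc j)))) \<in> Cedge"
        if "B \<le> j" "Suc j < n" "z \<le> j + r" "j < z + r" for j
        using hz(1)[of j] that z' B v r eq[of j] eq[of "Suc j"] unfolding z'_def by (simp add: max_def split: if_splits)
      moreover have "the (mu j) \<in> Cnode" if "B < j" "Suc j < n" "z < j + r" "j < z + r" for j
        using hz(2)[of j] that z' B v r eq[of j] unfolding z'_def by (simp add: max_def split: if_splits)
      moreover have "fst (the (mu (n - 1))) \<in> S" if "n - 1 < z + r"
        using hz(4) that z' B eq[of "n - 1"] by simp
      moreover have "the (mu z) \<in> D" if "h \<le> z" "z + h < n" "B < z"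
        using hz(5) that eq[of z] z unfolding z'_def by simp
      ultimately show ?thesis by blast
    qed
    moreover have "v \<le> B" "B < n" "B \<le> v + (K + 2 * r + 1)" "v + K \<le> B" "B \<noteq> n - 1"
      using B r unfolding B_def by auto
    ultimately show ?thesis by (intro exI[of _ B] exI[of _ y] exI[of _ 0]) simp
  qed
qed

text \<open>One walk overwrites everything from A to B, and other holes are left as they are. K < N
  makes the walk exist when A and B are the two ends of a long path.\<close>

lemma O1_mendable_verifier:
  assumes r: "h \<le> r" "N \<le> r" "0 < N" "K < N" and solv: "\<And>n. n \<le> N \<Longrightarrow> \<exists>L. restricted h N n L"
  shows "O1_mendable r (verifier r h N)"
proof -
  \<comment> \<open>N reaches every node of a short path, where the labelling is replaced by a
    solution; K + 2r + 1 is the largest distance of A and B from v.\<close>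
  let ?t = "N + K + 2 * r + 1"
  have "\<exists>mu. is_mend r (verifier r h N) ?t n lam v mu"
    if v: "v < n" and lam: "relaxed_accepted r (verifier r h N) n lam" for n lam v
  proof (cases "n \<le> N")
    case True
    then obtain L where "restricted h N n L" using solv by blast
    then have "lcl_solution r (verifier r h N) n L" using lcl_solution_verifier h_pos r by blast
    then have "is_mend r (verifier r h N) ?t n lam v (\<lambda>u. Some (L u))"
      using True v unfolding is_mend_def relaxed_accepted_def relaxed_happy_def lcl_solution_def path_dist_le
      by auto
    then show ?thesis by blast
  next
    case False
    then have n: "N < n" by simp
    obtain A x hx where A: "A \<le> v" "v \<le> A + (K + 2 * r + 1)" "A = 0 \<or> A + K \<le> v"
      and x: "if A = 0 then x = (s, s) \<and> hx = h else x \<in> D \<and> hx = 0"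
      and left: "\<And>mu. \<lbrakk>\<forall>u<A. mu u = lam u; mu A = Some x\<rbrakk> \<Longrightarrow>
      (\<forall>z<n. (\<forall>u<n. u \<le> z + r \<and> z \<le> u + r \<longrightarrow> mu u \<noteq> None) \<longrightarrow>
        (\<forall>j<A. z \<le> j + r \<and> j < z + r \<longrightarrow> (snd (the (mu j)), fst (the (mu (Suc j)))) \<in> Cedge) \<and>
        (\<forall>j<A. 0 < j \<and> z < j + r \<and> j < z + r \<longrightarrow> the (mu j) \<in> Cnode) \<and>
        (z < r \<longrightarrow> snd (the (mu 0)) \<in> S) \<and>
        (h \<le> z \<and> z + h < n \<and> z < A \<longrightarrow> the (mu z) \<in> D))"
      using left_boundary[OF r(1,2) n r(3) v lam] by blast
    obtain B y hy where B: "v \<le> B" "B < n" "B \<le> v + (K + 2 * r + 1)" "B = n - 1 \<or> v + K \<le> B"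
      and y: "if B = n - 1 then y = (s, s) \<and> hy = h else y \<in> D \<and> hy = 0"
      and right: "\<And>mu. \<lbrakk>\<forall>u<n. B < u \<longrightarrow> mu u = lam u; mu B = Some y\<rbrakk> \<Longrightarrow>
      (\<forall>z<n. (\<forall>u<n. u \<le> z + r \<and> z \<le> u + r \<longrightarrow> mu u \<noteq> None) \<longrightarrow>
        (\<forall>j\<ge>B. Suc j < n \<and> z \<le> j + r \<and> j < z + r \<longrightarrow> (snd (the (mu j)), fst (the (mu (Suc j)))) \<in> Cedge) \<and>
        (\<forall>j>B. Suc j < n \<and> z < j + r \<and> j < z + r \<longrightarrow> the (mu j) \<in> Cnode) \<and>
        (n - 1 < z + r \<longrightarrow> fst (the (mu (n - 1))) \<in> S) \<and>
        (h \<le> z \<and> z + h < n \<and> B < z \<longrightarrow> the (mu z) \<in> D))"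
      using right_boundary[OF r(1,2) n r(3) v lam] by blast
    have "K \<le> B - A" using A B n r by auto
    moreover have "terminal s h x hx" "terminal s h y hy"
      using x y unfolding terminal_def by (meson, meson)
    ultimately obtain p where "walk (B - A) x hx y hy p" using ex_walk by blast
    then have p: "p 0 = x" "p (B - A) = y" "\<And>j. j < B - A \<Longrightarrow> (snd (p j), fst (p (Suc j))) \<in> Cedge"
      "\<And>j. 0 < j \<Longrightarrow> j < B - A \<Longrightarrow> p j \<in> Cnode" "\<And>j. hx \<le> j \<Longrightarrow> j + hy \<le> B - A \<Longrightarrow> p j \<in> D"
      unfolding walk_def by auto
    define mu where "mu u = (if A \<le> u \<and> u \<le> B then Some (p (u - A)) else lam u)" for u
    have mid: "the (mu u) = p (u - A)" if "A \<le> u" "u \<le> B" for u using that by (simp add: mu_def)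
    have AB: "A \<le> B" using A B by simp
    have L: "\<forall>u<A. mu u = lam u" "mu A = Some x" using AB p by (auto simp: mu_def)
    have R: "\<forall>u<n. B < u \<longrightarrow> mu u = lam u" "mu B = Some y" using AB p by (auto simp: mu_def)
    have happy: "lcl_happy r (verifier r h N) n (\<lambda>u. the (mu u)) z"
      if z: "z < n" and free: "\<forall>u<n. u \<le> z + r \<and> z \<le> u + r \<longrightarrow> mu u \<noteq> None" for z
    proof -
      note l = left[OF L, rule_format, OF z free[rule_format]]
      note rt = right[OF R, rule_format, OF z free[rule_format]]
      have edge: "(snd (the (mu j)), fst (the (mu (Suc j)))) \<in> Cedge"
        if "z \<le> j + r" "j < z + r" "Suc j < n" for j
      proof -
        consider "j < A" | "A \<le> j" "j < B" | "B \<le> j" by linarith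
        then show ?thesis
        proof cases
          case 2
          then show ?thesis using p(3)[of "j - A"] mid[of j] mid[of "Suc j"] by (simp add: Suc_diff_le)
        qed (use l rt that in auto)
      qed
      have node: "the (mu j) \<in> Cnode" if "0 < j" "z < j + r" "j < z + r" "Suc j < n" for j
      proof -
        consider "j < A" | "j = A" | "A < j" "j < B" | "j = B" | "B < j" by linarith
        then show ?thesis
        proof cases
          case 2
          then show ?thesis using L(2) x that D_Cnode by auto
        next
          case 3
          then show ?thesis using p(4)[of "j - A"] mid[of j] by simp
        next
          case 4
          then have "B \<noteq> n - 1" using that by simp
          then show ?thesis using 4 R(2) y D_Cnode by auto
        qed (use l rt that in auto)
      qed
      have deep: "the (mu z) \<in> D" if "h \<le> z" "z + h < n"
      proof -
        consider "z < A" | "A \<le> z" "z \<le> B" | "B < z" by linarith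
        then show ?thesis
        proof cases
          case 2
          \<comment> \<open>At an end of the path the walk reaches \<open>D\<close> after h steps,
            which is exactly where the verifier starts to demand it.\<close>
          have "hx \<le> z - A" using x that 2 by (cases "A = 0") auto
          moreover have "z - A + hy \<le> B - A" using y that 2 by (cases "B = n - 1") auto
          ultimately show ?thesis using p(5)[of "z - A"] mid[of z] 2 by simp
        qed (use l rt that in auto)
      qed
      have "z < r \<Longrightarrow> snd (the (mu 0)) \<in> S" "n - 1 < z + r \<Longrightarrow> fst (the (mu (n - 1))) \<in> S"
        using l rt by simp_all
      then show ?thesis using edge node deep unfolding happy_iff[OF h_pos r(1,2) z] by simp
    qed
    have "relaxed_accepted r (verifier r h N) n mu"
      unfolding relaxed_accepted_def relaxed_happy_def path_dist_le
    proof (intro allI impI)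
      fix z assume "z < n"
      from happy[OF this]
      show "(\<exists>u<n. (u \<le> z + r \<and> z \<le> u + r) \<and> mu u = None) \<or> lcl_happy r (verifier r h N) n (\<lambda>u. the (mu u)) z"
        by meson
    qed
    moreover have "mu v \<noteq> None" using A B by (simp add: mu_def)
    moreover have "mu u = None \<longrightarrow> lam u = None" for u by (auto simp: mu_def)
    moreover have "mu u \<noteq> lam u \<longrightarrow> path_dist u v \<le> ?t" for u
      unfolding path_dist_le using A B by (auto simp: mu_def)
    ultimately have "is_mend r (verifier r h N) ?t n lam v mu" unfolding is_mend_def by blast
    then show ?thesis by blast
  qed
  then show ?thesis unfolding O1_mendable_def
    using orientation_invariant_verifier[OF h_pos, of r N] by blast
qed

end

section \<open>Algorithms as local functions\<close>

text \<open>The value \<open>None\<close> outside the path lets a local rule notice the ends;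
  integer positions admit translations and reflections.\<close>

definition path_ids :: "nat \<Rightarrow> (nat \<Rightarrow> nat) \<Rightarrow> int \<Rightarrow> nat option" where
  "path_ids n ids j = (if 0 \<le> j \<and> j < int n then Some (ids (nat j)) else None)"

definition view_iso :: "int \<Rightarrow> (int \<Rightarrow> nat option) \<Rightarrow> int \<Rightarrow> (int \<Rightarrow> nat option) \<Rightarrow> int \<Rightarrow> int \<Rightarrow> bool" where
  "view_iso T w i w' i' e \<longleftrightarrow> (e = 1 \<or> e = -1) \<and> (\<forall>j. \<bar>j\<bar> \<le> T \<longrightarrow> w' (i' + e * j) = w (i + j))"

text \<open>F w i d is the output of node i on its side in direction d, where d is 1 or -1. Invariance under
  translations and reflections makes F an algorithm on unoriented paths.\<close>

definition local_fun :: "int \<Rightarrow> ((int \<Rightarrow> nat option) \<Rightarrow> int \<Rightarrow> int \<Rightarrow> 'b) \<Rightarrow> bool" where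
  "local_fun T F \<longleftrightarrow> (\<forall>w i w' i' e d. view_iso T w i w' i' e \<longrightarrow> d = 1 \<or> d = -1 \<longrightarrow> F w' i' (e * d) = F w i d)"

lemma view_iso_shift:
  assumes "view_iso T w i w' i' e" "\<bar>m\<bar> + T' \<le> T"
  shows "view_iso T' w (i + m) w' (i' + e * m) e"
  using assms unfolding view_iso_def
proof (intro conjI allI impI)
  fix j assume j: "\<bar>j\<bar> \<le> T'"
  have "\<bar>m + j\<bar> \<le> T" using j assms(2) by linarith
  then have "w' (i' + e * (m + j)) = w (i + (m + j))" using assms(1) by (auto simp: view_iso_def)
  then show "w' (i' + e * m + e * j) = w (i + m + j)" by (simp add: algebra_simps)
qed auto

lemma view_iso_at:
  "view_iso T w i w' i' e \<Longrightarrow> \<bar>m\<bar> \<le> T \<Longrightarrow> w' (i' + e * m) = w (i + m)"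
  by (simp add: view_iso_def)

lemma local_funD:
  assumes "local_fun T F" "view_iso T' w i w' i' e" "\<bar>m\<bar> + T \<le> T'" "d = 1 \<or> d = -1"
  shows "F w' (i' + e * m) (e * d) = F w (i + m) d"
  using assms view_iso_shift[OF assms(2,3)] unfolding local_fun_def by blast

lemma local_fun_mono:
  assumes "local_fun T F" "T \<le> T'"
  shows "local_fun T' F"
  unfolding local_fun_def using local_funD[OF assms(1), where m = 0] assms(2) by simp

text \<open>A view fixes the identifiers up to reflection. Rebuilding it around the origin turns the
  exchange of its two sides into the reflection with e = -1. The congruence premise is there because
  the outputs agree with F at the nodes below n only.\<close>

lemma local_fun_solvable:
  assumes F: "local_fun (int T) F"
    and cong: "\<And>L L'. (\<And>i. i < n \<Longrightarrow> L i = L' i) \<Longrightarrow> P n L \<Longrightarrow> P n L'"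
    and sol: "\<And>ids. valid_ids c n ids \<Longrightarrow>
      P n (\<lambda>i. (F (path_ids n ids) (int i) (-1), F (path_ids n ids) (int i) 1))"
  shows "solvable_in_rounds c P n T"
proof -
  define side :: "nat list \<Rightarrow> nat \<Rightarrow> nat option" where
    "side xs m = (if m \<le> length xs then Some (xs ! (m - 1)) else None)" for xs m
  define w :: "nat list \<times> nat \<times> nat list \<Rightarrow> int \<Rightarrow> nat option" where
    "w v j = (if j = 0 then Some (fst (snd v)) else if 0 < j then side (snd (snd v)) (nat j)
      else side (fst v) (nat (- j)))" for v j
  define A :: "nat \<Rightarrow> nat list \<times> nat \<times> nat list \<Rightarrow> _" where
    "A n v = (F (w v) 0 (-1), F (w v) 0 1)" for n :: nat and v
  have "unoriented_alg A" unfolding unoriented_alg_def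
  proof (intro allI)
    fix n xs x ys
    have "view_iso (int T) (w (xs, x, ys)) 0 (w (ys, x, xs)) 0 (-1)"
      unfolding view_iso_def w_def by auto
    then show "A n (ys, x, xs) = prod.swap (A n (xs, x, ys))"
      using local_funD[OF F, of "int T" "w (xs, x, ys)" 0 "w (ys, x, xs)" 0 "-1" 0 1]
        local_funD[OF F, of "int T" "w (xs, x, ys)" 0 "w (ys, x, xs)" 0 "-1" 0 "-1"]
      unfolding A_def by simp
  qed
  moreover have "P n (\<lambda>i. A n (local_view T n ids i))" if ids: "valid_ids c n ids" for ids
  proof (rule cong[OF _ sol[OF ids]])
    fix i assume i: "i < n"
    have "view_iso (int T) (path_ids n ids) (int i) (w (local_view T n ids i)) 0 1"
      unfolding view_iso_def
    proof (intro conjI allI impI)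
      fix j :: int assume j: "\<bar>j\<bar> \<le> int T"
      consider "j = 0" | "0 < j" | "j < 0" by linarith
      then show "w (local_view T n ids i) (0 + 1 * j) = path_ids n ids (int i + j)"
      proof cases
        case 2
        let ?m = "nat j"
        have m: "j = int ?m" "0 < ?m" "?m \<le> T" using 2 j by auto
        have len: "length (map ids [Suc i..<min n (Suc (i + T))]) = min (n - Suc i) T"
          using i by (auto simp: min_def)
        have "side (map ids [Suc i..<min n (Suc (i + T))]) ?m = path_ids n ids (int i + j)"
        proof (cases "i + ?m < n")
          case True
          then have "Suc i + (?m - 1) < min n (Suc (i + T))" using m by auto
          then have "map ids [Suc i..<min n (Suc (i + T))] ! (?m - 1) = ids (Suc i + (?m - 1))"
            by (subst nth_map) (auto simp: nth_upt simp del: upt_Suc)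
          moreover have "?m \<le> length (map ids [Suc i..<min n (Suc (i + T))])"
            unfolding len using True m by auto
          moreover have "nat (int i + j) = Suc i + (?m - 1)" "0 \<le> int i + j" "int i + j < int n"
            using m True by auto
          ultimately show ?thesis unfolding side_def path_ids_def by (simp only: simp_thms if_True)
        next
          case False
          then have "\<not> ?m \<le> min (n - Suc i) T" using i by auto
          then show ?thesis using False m len unfolding side_def path_ids_def by auto
        qed
        then show ?thesis using 2 by (simp add: w_def local_view_def)
      next
        case 3
        let ?m = "nat (- j)"
        have m: "j = - int ?m" "0 < ?m" "?m \<le> T" using 3 j by auto
        have len: "length (rev (map ids [i - T..<i])) = min i T" by auto
        have "side (rev (map ids [i - T..<i])) ?m = path_ids n ids (int i + j)"
        proof (cases "?m \<le> i")
          case True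
          have "?m - 1 < length (map ids [i - T..<i])" using True m by auto
          from rev_nth[OF this] have "rev (map ids [i - T..<i]) ! (?m - 1)
              = map ids [i - T..<i] ! (length (map ids [i - T..<i]) - Suc (?m - 1))" .
          also have "length (map ids [i - T..<i]) - Suc (?m - 1) = i - (i - T) - ?m" using m by simp
          also have "map ids [i - T..<i] ! (i - (i - T) - ?m) = ids (i - ?m)"
            using True m by (simp add: nth_map_upt)
          finally have "rev (map ids [i - T..<i]) ! (?m - 1) = ids (i - ?m)" .
          moreover have "nat (int i + j) = i - ?m" "0 \<le> int i + j" "int i + j < int n" using m True i by auto
          moreover have "?m \<le> length (rev (map ids [i - T..<i]))" unfolding len using True m by simp
          ultimately show ?thesis unfolding side_def path_ids_def by (simp only: simp_thms if_True)
        next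
          case False
          then have "\<not> ?m \<le> length (rev (map ids [i - T..<i]))" unfolding len by simp
          moreover have "\<not> 0 \<le> int i + j" using False m by simp
          ultimately show ?thesis unfolding side_def path_ids_def by simp
        qed
        then show ?thesis using 3 by (simp add: w_def local_view_def)
      qed (use i in \<open>simp add: w_def local_view_def path_ids_def\<close>)
    qed auto
    then show "(F (path_ids n ids) (int i) (-1), F (path_ids n ids) (int i) 1) = A n (local_view T n ids i)"
      using local_funD[OF F, of "int T" "path_ids n ids" "int i" "w (local_view T n ids i)" 0 1 0 1]
        local_funD[OF F, of "int T" "path_ids n ids" "int i" "w (local_view T n ids i)" 0 1 0 "-1"]
      unfolding A_def by simp
  qed
  ultimately show ?thesis unfolding solvable_in_rounds_def by blast
qed

section \<open>Labelling between anchors\<close>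

context terminal_walks
begin

context
  fixes J :: "(int \<Rightarrow> nat option) \<Rightarrow> int \<Rightarrow> bool"
    and Or :: "(int \<Rightarrow> nat option) \<Rightarrow> int \<Rightarrow> int \<Rightarrow> bool"
    and B :: nat
begin

definition path_end :: "(int \<Rightarrow> nat option) \<Rightarrow> int \<Rightarrow> bool" where
  "path_end w i \<longleftrightarrow> w i \<noteq> None \<and> (w (i - 1) = None \<or> w (i + 1) = None)"

definition anchor :: "(int \<Rightarrow> nat option) \<Rightarrow> int \<Rightarrow> bool" where
  "anchor w i \<longleftrightarrow> path_end w i \<or> J w i"

text \<open>The state is read in direction d, its second component pointing ahead.
  \<open>Or w i d\<close> tells whether \<open>q\<close> is laid out in that direction; read the
  other way it appears mirrored.\<close>

definition anchor_state :: "(int \<Rightarrow> nat option) \<Rightarrow> int \<Rightarrow> int \<Rightarrow> 'g \<times> 'g" where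
  "anchor_state w i d = (if path_end w i then (s, s) else if Or w i d then q else prod.swap q)"

definition anchor_depth :: "(int \<Rightarrow> nat option) \<Rightarrow> int \<Rightarrow> nat" where
  "anchor_depth w i = (if path_end w i then h else 0)"

text \<open>The cap \<open>B\<close> keeps the search local and ensures that the minimum exists; it
  is chosen so that no gap exceeds it.\<close>

definition next_anchor :: "(int \<Rightarrow> nat option) \<Rightarrow> int \<Rightarrow> int \<Rightarrow> nat" where
  "next_anchor w i d = (LEAST m. 0 < m \<and> (anchor w (i + d * int m) \<or> B \<le> m))"

definition some_walk :: "nat \<Rightarrow> 'g \<times> 'g \<Rightarrow> nat \<Rightarrow> 'g \<times> 'g \<Rightarrow> nat \<Rightarrow> nat \<Rightarrow> 'g \<times> 'g" where
  "some_walk k x hx y hy = (SOME p. walk k x hx y hy p)"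

lemma walk_some_walk: "walk k x hx y hy p \<Longrightarrow> walk k x hx y hy (some_walk k x hx y hy)"
  unfolding some_walk_def by (rule someI[where P = "walk k x hx y hy"])

text \<open>Between two anchors the walk starts at the smaller identifier, since a walk between mirror
  images need not be its own mirror image.\<close>

definition fill :: "(int \<Rightarrow> nat option) \<Rightarrow> int \<Rightarrow> int \<Rightarrow> 'g" where
  "fill w i d = (if anchor w i then snd (anchor_state w i d) else
     let a = next_anchor w i (- d); b = next_anchor w i d; u = i - d * int a; v = i + d * int b in
     if the (w u) < the (w v)
     then snd (some_walk (a + b) (anchor_state w u d) (anchor_depth w u) (anchor_state w v d) (anchor_depth w v) a)
     else fst (some_walk (a + b) (anchor_state w v (- d)) (anchor_depth w v) (anchor_state w u (- d)) (anchor_depth w u) b))"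

text \<open>At most B steps lead to the neighbouring anchors, and T more evaluate \<open>J\<close>
  and \<open>Or\<close> there; T \<ge> 1 lets an anchor see whether it is an end of the
  path.\<close>

lemma local_fill:
  assumes J: "local_fun T (\<lambda>w i d. J w i)" and Or: "local_fun T Or" and T: "1 \<le> T" and B: "0 < B"
  shows "local_fun (int B + T) fill"
  unfolding local_fun_def
proof (intro allI impI)
  fix w i w' i' e and d :: int
  assume iso: "view_iso (int B + T) w i w' i' e" and d: "d = 1 \<or> d = -1"
  have ed: "e = 1 \<or> e = -1" using iso by (simp add: view_iso_def)
  have path_end: "path_end w' (i' + e * m) \<longleftrightarrow> path_end w (i + m)" if "\<bar>m\<bar> \<le> int B" for m
  proof -
    have "w' (i' + e * m) = w (i + m)" "w' (i' + e * (m + 1)) = w (i + (m + 1))"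
      "w' (i' + e * (m - 1)) = w (i + (m - 1))"
      by (rule view_iso_at[OF iso]; use that T in linarith)+
    then show ?thesis using ed unfolding path_end_def by (auto simp: algebra_simps)
  qed
  have anchor: "anchor w' (i' + e * m) \<longleftrightarrow> anchor w (i + m)" if "\<bar>m\<bar> \<le> int B" for m
    using path_end[OF that] local_funD[OF J iso, of m 1] that unfolding anchor_def by simp
  have state: "anchor_state w' (i' + e * m) (e * d) = anchor_state w (i + m) d"
    if "\<bar>m\<bar> \<le> int B" "d = 1 \<or> d = -1" for m d
    using path_end[OF that(1)] local_funD[OF Or iso, of m d] that unfolding anchor_state_def by simp
  have depth: "anchor_depth w' (i' + e * m) = anchor_depth w (i + m)" if "\<bar>m\<bar> \<le> int B" for m
    using path_end[OF that] unfolding anchor_depth_def by simp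
  have "next_anchor w' i' (e * d) = next_anchor w i d \<and> next_anchor w i d \<le> B"
    if d: "d = 1 \<or> d = -1" for d :: int
  proof -
    have "(0 < m \<and> (anchor w' (i' + e * d * int m) \<or> B \<le> m)) \<longleftrightarrow>
        (0 < m \<and> (anchor w (i + d * int m) \<or> B \<le> m))" for m
      using anchor[of "d * int m"] d by (cases "m \<le> B") (auto simp: mult.assoc)
    then show ?thesis unfolding next_anchor_def using B by (auto intro: Least_le)
  qed
  from this[OF d] this[of "- d"] d
  have nxt: "next_anchor w' i' (e * d) = next_anchor w i d" "next_anchor w' i' (- (e * d)) = next_anchor w i (- d)"
    and le: "next_anchor w i d \<le> B" "next_anchor w i (- d) \<le> B" by auto
  define a b where "a = next_anchor w i (- d)" and "b = next_anchor w i d"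
  have ab: "\<bar>- d * int a\<bar> \<le> int B" "\<bar>d * int b\<bar> \<le> int B"
    using le d by (auto simp: a_def b_def)
  have pos: "i' - e * d * int a = i' + e * (- d * int a)" "i' + e * d * int b = i' + e * (d * int b)"
    "i - d * int a = i + - d * int a" "- (e * d) = e * - d"
    by (simp_all add: mult.assoc)
  have d': "- d = 1 \<or> - d = -1" using d by auto
  have "w' (i' + e * (- d * int a)) = w (i + - d * int a)" "w' (i' + e * (d * int b)) = w (i + d * int b)"
    by (rule view_iso_at[OF iso]; use ab T in linarith)+
  then have w: "w' (i' + e * (- d * int a)) = w (i + - d * int a)" "w' (i' + e * (d * int b)) = w (i + d * int b)"
    by blast+
  have "anchor w' i' = anchor w i" "anchor_state w' i' (e * d) = anchor_state w i d"
    using anchor[of 0] state[of 0, OF _ d] by simp_all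
  then show "fill w' i' (e * d) = fill w i d"
    unfolding fill_def Let_def nxt a_def[symmetric] b_def[symmetric]
    by (simp only: pos w state[OF ab(1) d] state[OF ab(2) d] state[OF ab(1) d'] state[OF ab(2) d']
        depth[OF ab(1)] depth[OF ab(2)])
qed

lemma anchor_state_reverse:
  assumes "anchor w i" "J w i \<Longrightarrow> Or w i (-1) \<longleftrightarrow> \<not> Or w i 1"
  shows "anchor_state w i (-1) = prod.swap (anchor_state w i 1)"
  using assms unfolding anchor_def anchor_state_def by auto

lemma fill_anchor:
  assumes "anchor w i" "J w i \<Longrightarrow> Or w i (-1) \<longleftrightarrow> \<not> Or w i 1"
  shows "(fill w i (-1), fill w i 1) = anchor_state w i 1"
  using assms(1) anchor_state_reverse[OF assms] by (simp add: fill_def prod_eq_iff)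

lemma path_end_iff: "path_end (path_ids n ids) i \<longleftrightarrow> 0 \<le> i \<and> i < int n \<and> (i = 0 \<or> i = int n - 1)"
  by (auto simp: path_end_def path_ids_def)

text \<open>All nodes of a gap find the same two anchors and agree on the smaller identifier, hence
  on the chosen walk. If the right anchor has the smaller identifier, the gap carries the mirror
  image of the walk chosen from the right.\<close>

lemma walk_eq_fill:
  fixes n ids i1 i2
  defines "w \<equiv> path_ids n ids"
  assumes ids: "inj_on ids {..<n}"
    and Or: "\<And>i. J w i \<Longrightarrow> Or w i (-1) \<longleftrightarrow> \<not> Or w i 1"
    and range: "0 \<le> i1" "i1 < i2" "i2 < int n" and gap: "i2 - i1 \<le> int B"
    and anchors: "anchor w i1" "anchor w i2" "\<And>i. i1 < i \<Longrightarrow> i < i2 \<Longrightarrow> \<not> anchor w i"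
    and ex: "\<exists>p. walk (nat (i2 - i1)) (anchor_state w i1 1) (anchor_depth w i1)
      (anchor_state w i2 1) (anchor_depth w i2) p"
  shows "\<exists>p. walk (nat (i2 - i1)) (anchor_state w i1 1) (anchor_depth w i1)
      (anchor_state w i2 1) (anchor_depth w i2) p \<and>
    (\<forall>i. i1 \<le> i \<and> i \<le> i2 \<longrightarrow> (fill w i (-1), fill w i 1) = p (nat (i - i1)))"
proof -
  let ?k = "nat (i2 - i1)"
  have swap: "anchor_state w i (-1) = prod.swap (anchor_state w i 1)" if "anchor w i" for i
    by (rule anchor_state_reverse[OF that Or])
  have "nat i1 \<noteq> nat i2" "nat i1 < n" "nat i2 < n" using range by auto
  then have ne: "the (w i1) \<noteq> the (w i2)"
    using range inj_onD[OF ids, of "nat i1" "nat i2"] unfolding w_def path_ids_def by auto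
  define p where "p = some_walk ?k (anchor_state w i1 1) (anchor_depth w i1) (anchor_state w i2 1) (anchor_depth w i2)"
  define p' where "p' = some_walk ?k (anchor_state w i2 (-1)) (anchor_depth w i2) (anchor_state w i1 (-1)) (anchor_depth w i1)"
  have p: "walk ?k (anchor_state w i1 1) (anchor_depth w i1) (anchor_state w i2 1) (anchor_depth w i2) p"
    unfolding p_def using ex walk_some_walk by blast
  have "walk ?k (anchor_state w i2 (-1)) (anchor_depth w i2) (anchor_state w i1 (-1)) (anchor_depth w i1) p'"
    unfolding p'_def using walk_swap[OF p]
    unfolding swap[OF anchors(1)] swap[OF anchors(2)] by (rule walk_some_walk)
  from walk_swap[OF this]
  have p': "walk ?k (anchor_state w i1 1) (anchor_depth w i1) (anchor_state w i2 1) (anchor_depth w i2)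
      (\<lambda>j. prod.swap (p' (?k - j)))"
    unfolding swap[OF anchors(1)] swap[OF anchors(2)] swap_swap .
  define f where "f = (if the (w i1) < the (w i2) then p else (\<lambda>j. prod.swap (p' (?k - j))))"
  have walk_f: "walk ?k (anchor_state w i1 1) (anchor_depth w i1) (anchor_state w i2 1) (anchor_depth w i2) f"
    unfolding f_def using p p' by simp
  have "(fill w i (-1), fill w i 1) = f (nat (i - i1))" if i: "i1 \<le> i" "i \<le> i2" for i
  proof -
    consider "i = i1" | "i = i2" | "i1 < i" "i < i2" using i by linarith
    then show ?thesis
    proof cases
      case 3
      define a b where "a = nat (i - i1)" and "b = nat (i2 - i)"
      have ab: "i - int a = i1" "i + int b = i2" "0 < a" "0 < b" "int a < B" "int b < B" "a + b = ?k" "?k - a = b"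
        using 3 gap by (auto simp: a_def b_def)
      have "next_anchor w i 1 = b" unfolding next_anchor_def
      proof (rule Least_equality)
        fix m assume m: "0 < m \<and> (anchor w (i + 1 * int m) \<or> B \<le> m)"
        show "b \<le> m" using anchors(3)[of "i + int m"] m ab 3 by (intro leI notI) auto
      qed (use ab anchors in auto)
      moreover have "next_anchor w i (-1) = a" unfolding next_anchor_def
      proof (rule Least_equality)
        fix m assume m: "0 < m \<and> (anchor w (i + -1 * int m) \<or> B \<le> m)"
        show "a \<le> m" using anchors(3)[of "i - int m"] m ab 3 by (intro leI notI) auto
      qed (use ab anchors in auto)
      ultimately show ?thesis using anchors(3)[OF 3] ab ne
        unfolding fill_def f_def p_def p'_def Let_def a_def[symmetric]
        by (auto simp: add.commute[of b a] prod_eq_iff)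
    next
      case 1
      then show ?thesis using walk_f fill_anchor[OF anchors(1) Or] by (simp add: walk_def)
    next
      case 2
      then show ?thesis using walk_f fill_anchor[OF anchors(2) Or] by (simp add: walk_def)
    qed
  qed
  then show ?thesis using walk_f by blast
qed

text \<open>Since the ends of the path are anchors, every edge lies in a gap between consecutive
  anchors, and all constraints inside a gap are those of a walk.\<close>

lemma fill_restricted:
  fixes n ids
  defines "w \<equiv> path_ids n ids"
  assumes ids: "inj_on ids {..<n}" and n: "2 \<le> n"
    and Or: "\<And>i. J w i \<Longrightarrow> Or w i (-1) \<longleftrightarrow> \<not> Or w i 1"
    and segments: "\<And>i1 i2. \<lbrakk>0 \<le> i1; i1 < i2; i2 < int n; anchor w i1; anchor w i2;
      \<And>i. i1 < i \<Longrightarrow> i < i2 \<Longrightarrow> \<not> anchor w i\<rbrakk> \<Longrightarrow>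
      i2 - i1 \<le> int B \<and> (\<exists>p. walk (nat (i2 - i1)) (anchor_state w i1 1) (anchor_depth w i1)
        (anchor_state w i2 1) (anchor_depth w i2) p)"
  shows "restricted h N n (\<lambda>i. (fill w (int i) (-1), fill w (int i) 1))"
proof -
  let ?L = "\<lambda>i. (fill w (int i) (-1), fill w (int i) 1)"
  have ends: "path_end w i \<longleftrightarrow> i = 0 \<or> i = int n - 1" if "0 \<le> i" "i < int n" for i
    using that by (simp add: w_def path_end_iff)
  have a0: "anchor w 0" "anchor w (int n - 1)" using n by (auto simp: anchor_def ends)
  have segment: "\<exists>i1 i2 p. i1 \<le> i \<and> i < i2 \<and> i2 < n \<and> anchor w (int i1) \<and>
      walk (i2 - i1) (anchor_state w i1 1) (anchor_depth w i1) (anchor_state w i2 1) (anchor_depth w i2) p \<and>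
      ?L i = p (i - i1) \<and> ?L (Suc i) = p (Suc i - i1)" if i: "Suc i < n" for i
  proof -
    define i1 where "i1 = Max {j. j \<le> i \<and> anchor w (int j)}"
    have "i1 \<in> {j. j \<le> i \<and> anchor w (int j)}" unfolding i1_def
      using a0 by (intro Max_in) (auto intro!: exI[of _ 0])
    then have i1: "i1 \<le> i" "anchor w (int i1)" by auto
    have i1_max: "j \<le> i1" if "j \<le> i" "anchor w (int j)" for j
      unfolding i1_def using that by (intro Max_ge) auto
    define i2 where "i2 = (LEAST j. i < j \<and> anchor w (int j))"
    have ex: "i < n - 1 \<and> anchor w (int (n - 1))" using a0 i by (simp add: of_nat_diff)
    have i2: "i < i2 \<and> anchor w (int i2)" unfolding i2_def using ex by (rule LeastI)
    have i2_min: "i2 \<le> j" if "i < j" "anchor w (int j)" for j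
      unfolding i2_def using that by (intro Least_le) simp
    have "i2 < n" using i2_min[of "n - 1"] ex i by simp
    have none: "\<not> anchor w j" if "int i1 < j" "j < int i2" for j
    proof
      assume "anchor w j"
      moreover have "j = int (nat j)" using that by simp
      ultimately have "anchor w (int (nat j))" by simp
      then show False using i1_max[of "nat j"] i2_min[of "nat j"] that by (cases "nat j \<le> i") auto
    qed
    have seg: "int i2 - int i1 \<le> int B \<and> (\<exists>p. walk (nat (int i2 - int i1)) (anchor_state w i1 1)
        (anchor_depth w i1) (anchor_state w i2 1) (anchor_depth w i2) p)"
      using i1 i2 \<open>i2 < n\<close> none by (intro segments) auto
    obtain p where p: "walk (nat (int i2 - int i1)) (anchor_state w i1 1) (anchor_depth w i1)
        (anchor_state w i2 1) (anchor_depth w i2) p"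
      "\<And>j. int i1 \<le> j \<Longrightarrow> j \<le> int i2 \<Longrightarrow> (fill w j (-1), fill w j 1) = p (nat (j - int i1))"
      using walk_eq_fill[OF ids, of "int i1" "int i2"] Or i1 i2 \<open>i2 < n\<close> none seg
      unfolding w_def by auto
    have "nat (int i2 - int i1) = i2 - i1" "nat (int i - int i1) = i - i1"
      "nat (int (Suc i) - int i1) = Suc i - i1" by auto
    then show ?thesis using p(1) p(2)[of "int i"] p(2)[of "int (Suc i)"] i1 i2 \<open>i2 < n\<close>
      by (intro exI[of _ i1] exI[of _ i2] exI[of _ p]) auto
  qed
  have anchor_L: "?L i = anchor_state w i 1" if "anchor w (int i)" for i
    by (rule fill_anchor[OF that Or])
  have edge: "(snd (?L i), fst (?L (Suc i))) \<in> Cedge" if i: "Suc i < n" for i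
  proof -
    obtain i1 i2 p where p: "i1 \<le> i" "i < i2"
      "walk (i2 - i1) (anchor_state w i1 1) (anchor_depth w i1) (anchor_state w i2 1) (anchor_depth w i2) p"
      "?L i = p (i - i1)" "?L (Suc i) = p (Suc i - i1)" using segment[OF i] by blast
    have "i - i1 < i2 - i1" "Suc i - i1 = Suc (i - i1)" using p by auto
    then show ?thesis using p(3) unfolding p(4,5) walk_def by simp
  qed
  have node: "?L i \<in> Cnode" if i: "0 < i" "Suc i < n" for i
  proof (cases "anchor w (int i)")
    case True
    then have "?L i = q \<or> ?L i = prod.swap q"
      unfolding anchor_L[OF True] anchor_state_def using ends[of "int i"] i by auto
    then show ?thesis using D_Cnode[OF q_D] swap_Cnode by metis
  next
    case False
    obtain i1 i2 p where p: "i1 \<le> i" "i < i2" "anchor w (int i1)"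
      "walk (i2 - i1) (anchor_state w i1 1) (anchor_depth w i1) (anchor_state w i2 1) (anchor_depth w i2) p"
      "?L i = p (i - i1)" using segment[OF i(2)] by blast
    then have "i1 \<noteq> i" using False by auto
    then have "0 < i - i1" "i - i1 < i2 - i1" using p by auto
    then show ?thesis using p(4) unfolding p(5) walk_def by simp
  qed
  have deep: "?L i \<in> D" if i: "h \<le> i" "i + h < n" for i
  proof -
    have i': "0 < i" "Suc i < n" using i h_pos by auto
    obtain i1 i2 p where p: "i1 \<le> i" "i < i2" "i2 < n"
      "walk (i2 - i1) (anchor_state w i1 1) (anchor_depth w i1) (anchor_state w i2 1) (anchor_depth w i2) p"
      "?L i = p (i - i1)" using segment[OF i'(2)] by blast
    have "anchor_depth w i1 \<le> i - i1"
      using ends[of "int i1"] p i i' unfolding anchor_depth_def by auto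
    moreover have "i - i1 + anchor_depth w i2 \<le> i2 - i1"
      using ends[of "int i2"] p i i' unfolding anchor_depth_def by auto
    ultimately show ?thesis using p(4) unfolding p(5) walk_def by simp
  qed
  have "?L 0 = (s, s)" "?L (n - 1) = (s, s)"
    using anchor_L[of 0] anchor_L[of "n - 1"] a0 n ends[of 0] ends[of "int n - 1"]
    by (auto simp: anchor_state_def of_nat_diff)
  then show ?thesis unfolding restricted_def necl_solution_def
    using edge node deep s_S by auto
qed

end

text \<open>At distance one the state q may simply be repeated when it is a loop; all other gaps are long
  enough for an arbitrary walk.\<close>

lemma solvable_of_anchors:
  fixes J :: "(int \<Rightarrow> nat option) \<Rightarrow> int \<Rightarrow> bool" and M G T T' :: nat
  assumes J: "local_fun (int T) (\<lambda>w i d. J w i)" and Or: "local_fun (int T) Or"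
    and M: "K \<le> M" "0 < M" and n: "K + 2 \<le> n"
    and props: "\<And>ids w i. \<lbrakk>valid_ids c n ids; w = path_ids n ids; J w i\<rbrakk> \<Longrightarrow>
      int M \<le> i \<and> i + int M < int n \<and> (Or w i (-1) \<longleftrightarrow> \<not> Or w i 1)"
    and gap: "\<And>ids w i1 i2. \<lbrakk>valid_ids c n ids; w = path_ids n ids; J w i1; J w i2; i1 < i2;
      \<And>i. i1 < i \<Longrightarrow> i < i2 \<Longrightarrow> \<not> J w i\<rbrakk> \<Longrightarrow>
      int K \<le> i2 - i1 \<or> i2 = i1 + 1 \<and> (Or w i1 1 \<longleftrightarrow> Or w i2 1) \<and> (q, q) \<in> R"
    and dense: "\<And>ids w i. \<lbrakk>valid_ids c n ids; w = path_ids n ids; int M \<le> i; i + int G + int M < int n\<rbrakk> \<Longrightarrow>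
      \<exists>j. i \<le> j \<and> j \<le> i + int G \<and> J w j"
    and T': "2 * M + G + T + 3 \<le> T'"
  shows "solvable_in_rounds c (restricted h N) n T'"
proof -
  \<comment> \<open>A longer gap would contain, M + 1 steps after its left anchor, a stretch of G +
    1 nodes at distance at least M from both ends, and thus another anchor.\<close>
  let ?B = "2 * M + G + 2"
  have "local_fun (int ?B + int (T + 1)) (fill J Or ?B)"
    by (rule local_fill) (use local_fun_mono[OF J] local_fun_mono[OF Or] in auto)
  then have F: "local_fun (int T') (fill J Or ?B)"
    by (rule local_fun_mono) (use T' in simp)
  show ?thesis
  proof (rule local_fun_solvable[OF F])
    fix L L' assume eq: "\<And>i. i < n \<Longrightarrow> L i = L' i" and L: "restricted h N n L"
    show "restricted h N n L'"
      using L unfolding restricted_def necl_solution_def by (auto simp: eq)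
  next
    fix ids assume ids: "valid_ids c n ids"
    define w where "w = path_ids n ids"
    note props = props[OF ids w_def] and gap = gap[OF ids w_def] and dense = dense[OF ids w_def]
    have loop: "\<exists>p. walk 1 x 0 x 0 p" if "(q, q) \<in> R" "x = q \<or> x = prod.swap q" for x
      using that relpow_walk[of x x 1] R_swap[OF that(1)] q_D D_swap[OF q_D] by auto
    have inj: "inj_on ids {..<n}" using ids by (simp add: valid_ids_def)
    have ends: "path_end w i \<longleftrightarrow> i = 0 \<or> i = int n - 1" if "0 \<le> i" "i < int n" for i
      using that by (simp add: w_def path_end_iff)
    show "restricted h N n (\<lambda>i. (fill J Or ?B (path_ids n ids) (int i) (-1), fill J Or ?B (path_ids n ids) (int i) 1))"
    proof (rule fill_restricted[OF inj])
      fix i assume "J (path_ids n ids) i"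
      then show "Or (path_ids n ids) i (-1) \<longleftrightarrow> \<not> Or (path_ids n ids) i 1" using props unfolding w_def by blast
    next
      fix i1 i2 assume i: "0 \<le> i1" "i1 < i2" "i2 < int n"
        and anchors: "anchor J (path_ids n ids) i1" "anchor J (path_ids n ids) i2"
          "\<And>i. i1 < i \<Longrightarrow> i < i2 \<Longrightarrow> \<not> anchor J (path_ids n ids) i"
      note anchors = anchors[folded w_def]
      have noJ: "\<not> J w i" if "i1 < i" "i < i2" for i using anchors(3)[OF that] by (simp add: anchor_def)
      have "i2 - i1 \<le> int ?B"
      proof (rule ccontr)
        assume "\<not> i2 - i1 \<le> int ?B"
        then obtain j where "i1 + 1 + int M \<le> j" "j \<le> i1 + 1 + int M + int G" "J w j"
          using dense[of "i1 + 1 + int M"] i by auto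
        then show False using noJ[of j] \<open>\<not> i2 - i1 \<le> int ?B\<close> by simp
      qed
      moreover have "\<exists>p. walk (nat (i2 - i1)) (anchor_state Or w i1 1) (anchor_depth w i1)
        (anchor_state Or w i2 1) (anchor_depth w i2) p"
      proof (cases "int K \<le> i2 - i1")
        case True
        moreover have "terminal s h (anchor_state Or w i 1) (anchor_depth w i)" for i
          unfolding terminal_def anchor_state_def anchor_depth_def using q_D D_swap[OF q_D] by simp
        ultimately show ?thesis by (intro ex_walk) auto
      next
        case False
        \<comment> \<open>Nodes in \<open>J\<close> keep distance M \<ge> K from the ends, and the
          ends are at least K + 1 apart; a gap shorter than K therefore has no end of the path as an
          anchor.\<close>
        have "\<not> path_end w i1"
        proof
          assume "path_end w i1"
          then have "i1 = 0" using ends[of i1] i by auto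
          then show False using False anchors(2) props[of i2] ends[of i2] i n M by (auto simp: anchor_def)
        qed
        moreover have "\<not> path_end w i2"
        proof
          assume "path_end w i2"
          then have "i2 = int n - 1" using ends[of i2] i by auto
          then show False using False anchors(1) props[of i1] \<open>\<not> path_end w i1\<close> M by (auto simp: anchor_def)
        qed
        ultimately have "i2 = i1 + 1" "Or w i1 1 \<longleftrightarrow> Or w i2 1" "(q, q) \<in> R" "\<not> path_end w i1" "\<not> path_end w i2"
          using gap[of i1 i2] False anchors noJ i by (auto simp: anchor_def)
        then show ?thesis using loop unfolding anchor_state_def anchor_depth_def by simp
      qed
      ultimately show "i2 - i1 \<le> int ?B \<and> (\<exists>p. walk (nat (i2 - i1)) (anchor_state Or (path_ids n ids) i1 1)
        (anchor_depth (path_ids n ids) i1) (anchor_state Or (path_ids n ids) i2 1) (anchor_depth (path_ids n ids) i2) p)"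
        unfolding w_def by blast
    qed (use n in auto)
  qed
qed

end

section \<open>Outputs of a fast algorithm\<close>

lemma extend_ids:
  fixes f :: "nat \<Rightarrow> nat"
  assumes f: "inj_on f X" "f ` X \<subseteq> {1..M}" and X: "X \<subseteq> {..<n}" and n: "n \<le> M"
  shows "\<exists>g. inj_on g {..<n} \<and> g ` {..<n} \<subseteq> {1..M} \<and> (\<forall>a\<in>X. g a = f a)"
proof -
  have fin: "finite X" using X finite_subset by blast
  have "card ({..<n} - X) \<le> card ({1..M} - f ` X)"
    using f X n fin by (simp add: card_Diff_subset card_image)
  then obtain h where h: "inj_on h ({..<n} - X)" "h ` ({..<n} - X) \<subseteq> {1..M} - f ` X"
    using card_le_inj[of "{..<n} - X" "{1..M} - f ` X"] by auto
  let ?g = "\<lambda>a. if a \<in> X then f a else h a"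
  have "inj_on ?g {..<n}"
  proof (rule inj_onI)
    fix a b assume ab: "a \<in> {..<n}" "b \<in> {..<n}" "?g a = ?g b"
    show "a = b"
    proof (cases "a \<in> X"; cases "b \<in> X")
      assume "a \<in> X" "b \<in> X"
      then show ?thesis using ab f(1) by (auto dest: inj_onD)
    next
      assume *: "a \<in> X" "b \<notin> X"
      then have "h b \<in> {1..M} - f ` X" using ab h(2) by blast
      moreover have "f a = h b" using * ab(3) by simp
      ultimately show ?thesis using *(1) by (metis Diff_iff imageI)
    next
      assume *: "a \<notin> X" "b \<in> X"
      then have "h a \<in> {1..M} - f ` X" using ab h(2) by blast
      moreover have "f b = h a" using * ab(3) by simp
      ultimately show ?thesis using *(2) by (metis Diff_iff imageI)
    next
      assume "a \<notin> X" "b \<notin> X"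
      then show ?thesis using ab inj_onD[OF h(1), of a b] by auto
    qed
  qed
  moreover have "?g a \<in> {1..M}" if "a \<in> {..<n}" for a
    using that f(2) h(2) by (cases "a \<in> X") (auto simp: image_subset_iff)
  then have "?g ` {..<n} \<subseteq> {1..M}" by blast
  moreover have "\<forall>a\<in>X. ?g a = f a" by simp
  ultimately show ?thesis by blast
qed

lemma relpow_mult_add:
  assumes "(q, q) \<in> r ^^ a" "(q, q) \<in> r ^^ b"
  shows "(q, q) \<in> r ^^ (i * a + j * b)"
proof -
  have "(q, q) \<in> r ^^ (m * a)" if "(q, q) \<in> r ^^ a" for m a
    using that by (induction m) (auto simp: relpow_add)
  then show ?thesis using assms unfolding relpow_add by blast
qed

text \<open>The coin problem for a and a + 1: k is (k div a - k mod a) times a plus (k mod a) times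
  a + 1, and k \<ge> a * a makes the first coefficient nonnegative.\<close>

lemma relpow_eventually:
  assumes "(q, q) \<in> r ^^ a" "(q, q) \<in> r ^^ Suc a" "0 < a" "k \<ge> a * a"
  shows "(q, q) \<in> r ^^ k"
proof -
  have "k mod a < a" using assms(3) by simp
  moreover have "a \<le> k div a" using assms(3,4) by (simp add: less_eq_div_iff_mult_less_eq)
  ultimately have le: "k mod a \<le> k div a" by linarith
  have "(k div a - k mod a) * a + (k mod a) * Suc a = (k div a - k mod a + k mod a) * a + k mod a"
    by (simp add: algebra_simps)
  also have "\<dots> = k" using le by simp
  finally show ?thesis using relpow_mult_add[OF assms(1,2), of "k div a - k mod a" "k mod a"] by metis
qed

section \<open>Outputs at nodes whose view contains no end of the path\<close>

definition window_output :: "(nat \<Rightarrow> nat list \<times> nat \<times> nat list \<Rightarrow> 'b) \<Rightarrow> nat \<Rightarrow> nat \<Rightarrow> (int \<Rightarrow> nat) \<Rightarrow> 'b" where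
  "window_output A n T x =
    A n (map (\<lambda>j. x (- int j)) [1..<Suc T], x 0, map (\<lambda>j. x (int j)) [1..<Suc T])"

lemma window_output_reverse:
  assumes "unoriented_alg A"
  shows "window_output A n T (\<lambda>j. x (- j)) = prod.swap (window_output A n T x)"
  using assms unfolding unoriented_alg_def window_output_def minus_minus minus_zero by blast

lemma window_output_cong:
  assumes "\<And>j. \<bar>j\<bar> \<le> int T \<Longrightarrow> x j = y j"
  shows "window_output A n T x = window_output A n T y"
proof -
  have "map (\<lambda>j. x (- int j)) [1..<Suc T] = map (\<lambda>j. y (- int j)) [1..<Suc T]"
    "map (\<lambda>j. x (int j)) [1..<Suc T] = map (\<lambda>j. y (int j)) [1..<Suc T]" "x 0 = y 0"
    using assms by auto
  then show ?thesis by (simp only: window_output_def)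
qed

lemma local_view_output:
  assumes "T \<le> i" "i + T < n" and x: "\<And>j. \<bar>j\<bar> \<le> int T \<Longrightarrow> x j = ids (nat (int i + j))"
  shows "A n (local_view T n ids i) = window_output A n T x"
proof -
  have "rev (map ids [i - T..<i]) = map (\<lambda>j. x (- int j)) [1..<Suc T]"
  proof (rule nth_equalityI)
    fix k assume k: "k < length (rev (map ids [i - T..<i]))"
    then have k': "k < T" using assms by simp
    have "rev (map ids [i - T..<i]) ! k = map ids [i - T..<i] ! (length (map ids [i - T..<i]) - Suc k)"
      using k by (intro rev_nth) simp
    also have "\<dots> = ids (i - Suc k)" using k' assms(1) by (simp add: nth_map_upt)
    also have "\<dots> = x (- int (Suc k))"
    proof -
      have "int i + - int (Suc k) = int (i - Suc k)" using k' assms(1) by (simp add: of_nat_diff)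
      moreover have "x (- int (Suc k)) = ids (nat (int i + - int (Suc k)))" using k' by (intro x) simp
      ultimately show ?thesis by (simp only: nat_int)
    qed
    also have "\<dots> = map (\<lambda>j. x (- int j)) [1..<Suc T] ! k" using k' by (simp add: nth_map_upt del: upt_Suc)
    finally show "rev (map ids [i - T..<i]) ! k = map (\<lambda>j. x (- int j)) [1..<Suc T] ! k" .
  qed (use assms in simp)
  moreover have "map ids [Suc i..<min n (Suc (i + T))] = map (\<lambda>j. x (int j)) [1..<Suc T]"
  proof (rule nth_equalityI)
    fix k assume k: "k < length (map ids [Suc i..<min n (Suc (i + T))])"
    have k'': "min n (Suc (i + T)) = Suc (i + T)" using assms by auto
    have k': "k < T" using k unfolding k'' by (simp del: upt_Suc)
    have "map ids [Suc i..<Suc (i + T)] ! k = ids (Suc i + k)" using k' by (simp add: nth_map_upt del: upt_Suc)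
    also have "\<dots> = x (int (Suc k))"
    proof -
      have "int i + int (Suc k) = int (Suc i + k)" by simp
      moreover have "x (int (Suc k)) = ids (nat (int i + int (Suc k)))" using k' by (intro x) simp
      ultimately show ?thesis by (simp only: nat_int)
    qed
    also have "\<dots> = map (\<lambda>j. x (int j)) [1..<Suc T] ! k" using k' by (simp add: nth_map_upt del: upt_Suc)
    finally show "map ids [Suc i..<min n (Suc (i + T))] ! k = map (\<lambda>j. x (int j)) [1..<Suc T] ! k"
      unfolding k'' .
  qed (use assms in auto)
  ultimately show ?thesis using x[of 0] unfolding local_view_def window_output_def by simp
qed

text \<open>4T + 5 nodes hold two windows of 2T + 1 nodes with centres 2T + 2 apart and one further
  node at each end.\<close>

locale fast_algorithm = sym_lcl Cedge Cnode S
  for Cedge Cnode :: "('g::finite \<times> 'g) set" and S :: "'g set" +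
  fixes A :: "nat \<Rightarrow> nat list \<times> nat \<times> nat list \<Rightarrow> 'g \<times> 'g" and n T c :: nat
  assumes unoriented: "unoriented_alg A" and c: "1 \<le> c" and n: "4 * T + 5 \<le> n"
    and solves: "valid_ids c n ids \<Longrightarrow> necl_solution Cedge Cnode S S n (\<lambda>i. A n (local_view T n ids i))"
begin

definition nu :: "(int \<Rightarrow> nat) \<Rightarrow> 'g \<times> 'g" where "nu = window_output A n T"

definition window :: "int set \<Rightarrow> (int \<Rightarrow> nat) \<Rightarrow> bool" where
  "window X x \<longleftrightarrow> inj_on x X \<and> x ` X \<subseteq> {1..n ^ c}"

lemma n_le: "n \<le> n ^ c"
  using c n by (intro self_le_power) auto

lemma embed:
  assumes "inj_on f X" "f ` X \<subseteq> {1..n ^ c}" "X \<subseteq> {..<n}"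
  obtains ids where "valid_ids c n ids" "\<And>a. a \<in> X \<Longrightarrow> ids a = f a"
proof -
  obtain g where "inj_on g {..<n} \<and> g ` {..<n} \<subseteq> {1..n ^ c} \<and> (\<forall>a\<in>X. g a = f a)"
    using extend_ids[OF assms n_le] by (rule exE)
  then show thesis using that[of g] by (simp add: valid_ids_def)
qed

lemma output_walk:
  assumes "valid_ids c n ids" "0 < i" "i + m + 2 \<le> n"
  shows "A n (local_view T n ids i) \<in> Cnode"
    and "(A n (local_view T n ids i), A n (local_view T n ids (i + m))) \<in> R ^^ m"
proof -
  let ?L = "\<lambda>i. A n (local_view T n ids i)"
  have node: "?L j \<in> Cnode" if "0 < j" "j + 2 \<le> n" for j
    using solves[OF assms(1)] that unfolding necl_solution_def by simp
  have edge: "(snd (?L j), fst (?L (Suc j))) \<in> Cedge" if "Suc j < n" for j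
    using solves[OF assms(1)] that unfolding necl_solution_def by simp
  show "?L i \<in> Cnode" using node assms by simp
  show "(?L i, ?L (i + m)) \<in> R ^^ m" using assms(3)
  proof (induction m)
    case (Suc m)
    then have "(?L (i + m), ?L (i + Suc m)) \<in> R"
      using node[of "i + m"] node[of "i + Suc m"] edge[of "i + m"] assms(2) unfolding R_def by simp
    moreover have "(?L i, ?L (i + m)) \<in> R ^^ m" using Suc by simp
    ultimately show ?case by (rule relpow_Suc_I[rotated])
  qed simp
qed

lemma adjacent_windows:
  assumes x: "window {- int T..int T + 1} x"
  shows "(nu x, nu (\<lambda>j. x (j + 1))) \<in> R"
proof -
  let ?f = "\<lambda>a. x (int a - int (T + 1))"
  have img: "(\<lambda>a. int a - int (T + 1)) ` {1..2 * T + 2} \<subseteq> {- int T..int T + 1}" by auto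
  have "inj_on ?f {1..2 * T + 2}"
    using x img unfolding window_def inj_on_def by (auto simp: image_subset_iff) force
  moreover have "?f ` {1..2 * T + 2} \<subseteq> {1..n ^ c}"
    using x img unfolding window_def by (auto simp: image_subset_iff)
  ultimately obtain ids where ids: "valid_ids c n ids" "\<And>a. a \<in> {1..2 * T + 2} \<Longrightarrow> ids a = ?f a"
    using n embed[of ?f "{1..2 * T + 2}"] by (auto simp: subset_iff)
  have "A n (local_view T n ids (T + 1)) = nu x" unfolding nu_def
  proof (rule local_view_output)
    fix j assume j: "\<bar>j\<bar> \<le> int T"
    then have mem: "nat (int (T + 1) + j) \<in> {1..2 * T + 2}"
      and eq: "int (nat (int (T + 1) + j)) - int (T + 1) = j" by auto
    show "x j = ids (nat (int (T + 1) + j))" using ids(2)[OF mem] unfolding eq by (rule sym)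
  qed (use n in auto)
  moreover have "A n (local_view T n ids (T + 1 + 1)) = nu (\<lambda>j. x (j + 1))" unfolding nu_def
  proof (rule local_view_output)
    fix j assume j: "\<bar>j\<bar> \<le> int T"
    then have mem: "nat (int (T + 1 + 1) + j) \<in> {1..2 * T + 2}"
      and eq: "int (nat (int (T + 1 + 1) + j)) - int (T + 1) = j + 1" by auto
    show "x (j + 1) = ids (nat (int (T + 1 + 1) + j))" using ids(2)[OF mem] unfolding eq by (rule sym)
  qed (use n in auto)
  ultimately show ?thesis using output_walk(2)[OF ids(1), of "T + 1" 1] n by simp
qed

text \<open>Disjoint identifier sets let both windows coexist on one path, where correctness turns
  the outputs between the centres into a walk. The same path supplies the entrance: from node 1, the
  neighbour of an endpoint, T steps lead to the centre of the first window.\<close>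

lemma disjoint_windows:
  assumes x: "window {- int T..int T} x" and y: "window {- int T..int T} y"
    and disj: "x ` {- int T..int T} \<inter> y ` {- int T..int T} = {}"
    and k: "2 * T + 1 \<le> k" "k + 2 * T + 3 \<le> n"
  shows "(nu x, nu y) \<in> R ^^ k" and "nu x \<in> Cnode"
    and "\<exists>s\<in>S. \<exists>z\<in>Cnode. (s, fst z) \<in> Cedge \<and> (z, nu x) \<in> R\<^sup>*"
proof -
  let ?X = "{1..2 * T + 1}" and ?Y = "{k + 1..k + 2 * T + 1}" and ?W = "{- int T..int T}"
  let ?a = "\<lambda>a. int a - int (T + 1)" and ?b = "\<lambda>a. int a - int (T + 1 + k)"
  let ?f = "\<lambda>a. if a \<in> ?X then x (?a a) else y (?b a)"
  have fX: "?f a \<in> x ` ?W" if "a \<in> ?X" for a using that by auto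
  have fY: "?f a \<in> y ` ?W" if "a \<in> ?Y" for a using that k by auto
  have "inj_on ?f (?X \<union> ?Y)"
  proof (rule inj_onI)
    fix a b assume ab: "a \<in> ?X \<union> ?Y" "b \<in> ?X \<union> ?Y" "?f a = ?f b"
    consider "a \<in> ?X" "b \<in> ?X" | "a \<in> ?Y" "b \<in> ?Y" | "a \<in> ?X" "b \<in> ?Y" | "a \<in> ?Y" "b \<in> ?X"
      using ab by blast
    then show "a = b"
    proof cases
      case 1
      then have "x (?a a) = x (?a b)" using ab(3) by simp
      then have "?a a = ?a b" using 1 x unfolding window_def by (elim conjE inj_onD) auto
      then show ?thesis by simp
    next
      case 2
      then have "y (?b a) = y (?b b)" using ab(3) k by auto
      then have "?b a = ?b b" using 2 y unfolding window_def by (elim conjE inj_onD) auto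
      then show ?thesis by simp
    next
      case 3
      then show ?thesis using fX[OF 3(1)] fY[OF 3(2)] ab(3) disj by (metis disjoint_iff)
    next
      case 4
      then show ?thesis using fX[OF 4(2)] fY[OF 4(1)] ab(3) disj by (metis disjoint_iff)
    qed
  qed
  moreover have "?f a \<in> {1..n ^ c}" if "a \<in> ?X \<union> ?Y" for a
    using that fX[of a] fY[of a] x y unfolding window_def by blast
  then have "?f ` (?X \<union> ?Y) \<subseteq> {1..n ^ c}" by blast
  moreover have "?X \<union> ?Y \<subseteq> {..<n}" using k by auto
  ultimately obtain ids where ids: "valid_ids c n ids" "\<And>a. a \<in> ?X \<union> ?Y \<Longrightarrow> ids a = ?f a"
    by (rule embed) blast
  have Lx: "A n (local_view T n ids (T + 1)) = nu x" unfolding nu_def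
  proof (rule local_view_output)
    fix j assume j: "\<bar>j\<bar> \<le> int T"
    then have mem: "nat (int (T + 1) + j) \<in> ?X"
      and eq: "int (nat (int (T + 1) + j)) - int (T + 1) = j" by auto
    show "x j = ids (nat (int (T + 1) + j))" using ids(2)[OF UnI1[OF mem]] unfolding if_P[OF mem] eq by (rule sym)
  qed (use k in auto)
  have Ly: "A n (local_view T n ids (T + 1 + k)) = nu y" unfolding nu_def
  proof (rule local_view_output)
    fix j assume j: "\<bar>j\<bar> \<le> int T"
    then have mem: "nat (int (T + 1 + k) + j) \<in> ?Y" "nat (int (T + 1 + k) + j) \<notin> ?X"
      and eq: "int (nat (int (T + 1 + k) + j)) - int (T + 1 + k) = j" using k by auto
    show "y j = ids (nat (int (T + 1 + k) + j))"
      using ids(2)[OF UnI2[OF mem(1)]] unfolding if_not_P[OF mem(2)] eq by (rule sym)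
  qed (use k in auto)
  show "(nu x, nu y) \<in> R ^^ k" "nu x \<in> Cnode"
    using output_walk[OF ids(1), of "T + 1" k] Lx Ly k by simp_all
  let ?L = "\<lambda>i. A n (local_view T n ids i)"
  have "snd (?L 0) \<in> S" "(snd (?L 0), fst (?L 1)) \<in> Cedge"
    using solves[OF ids(1)] n unfolding necl_solution_def by simp_all
  moreover have "?L 1 \<in> Cnode" "(?L 1, ?L (1 + T)) \<in> R ^^ T"
    using output_walk[OF ids(1), of 1 T] k by simp_all
  moreover from this(2) have "(?L 1, nu x) \<in> R\<^sup>*"
    using Lx by (metis relpow_imp_rtrancl add.commute)
  ultimately show "\<exists>s\<in>S. \<exists>z\<in>Cnode. (s, fst z) \<in> Cedge \<and> (z, nu x) \<in> R\<^sup>*" by blast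
qed

text \<open>The mirror image of x uses the identifiers of x, so one auxiliary window y serves both
  for returning to \<open>nu x\<close> and for connecting it with its mirror image.\<close>

lemma flexible_window:
  assumes x: "window {- int T..int T} x"
  shows "flexible (nu x)"
proof -
  let ?W = "{- int T..int T}"
  have "card ?W = 2 * T + 1" by simp
  moreover have "card (x ` ?W) \<le> 2 * T + 1" using card_image_le[of ?W x] by simp
  then have "2 * T + 1 \<le> card ({1..n ^ c} - x ` ?W)"
    using diff_card_le_card_Diff[of "x ` ?W" "{1..n ^ c}"] n_le n by simp
  ultimately obtain y where "inj_on y ?W" "y ` ?W \<subseteq> {1..n ^ c} - x ` ?W"
    using card_le_inj[of ?W "{1..n ^ c} - x ` ?W"] by auto
  then have y: "window ?W y" and disj: "x ` ?W \<inter> y ` ?W = {}" by (auto simp: window_def)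
  have rev: "(\<lambda>j. x (- j)) ` ?W = x ` ?W"
  proof -
    have "uminus ` ?W = ?W" by simp
    then show ?thesis by (metis image_image)
  qed
  have x': "window ?W (\<lambda>j. x (- j))"
    using x unfolding window_def rev inj_on_def by (metis add.inverse_inverse atLeastAtMost_iff minus_le_iff neg_le_iff_le)
  have swap: "nu (\<lambda>j. x (- j)) = prod.swap (nu x)"
    unfolding nu_def using window_output_reverse[OF unoriented] .
  note xy = disjoint_windows[OF x y disj] and yx = disjoint_windows[OF y x]
  have k: "2 * T + 1 \<le> 2 * T + 1" "2 * T + 1 + 2 * T + 3 \<le> n" "2 * T + 1 \<le> 2 * T + 2" "2 * T + 2 + 2 * T + 3 \<le> n"
    using n by auto
  have disj': "y ` ?W \<inter> x ` ?W = {}" using disj by blast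
  have "(nu x, nu y) \<in> R ^^ (2 * T + 1)" "(nu x, nu y) \<in> R ^^ (2 * T + 2)" "(nu y, nu x) \<in> R ^^ (2 * T + 1)"
    using xy(1)[OF k(1,2)] xy(1)[OF k(3,4)] yx(1)[OF disj' k(1,2)] by blast+
  then have "(nu x, nu x) \<in> R ^^ (2 * T + 1) O R ^^ (2 * T + 1)" "(nu x, nu x) \<in> R ^^ (2 * T + 2) O R ^^ (2 * T + 1)"
    by blast+
  moreover have "(2 * T + 1) + (2 * T + 1) = 4 * T + 2" "(2 * T + 2) + (2 * T + 1) = Suc (4 * T + 2)" by auto
  ultimately have a: "(nu x, nu x) \<in> R ^^ (4 * T + 2)" "(nu x, nu x) \<in> R ^^ Suc (4 * T + 2)"
    by (simp_all only: relpow_add[symmetric])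
  have "\<forall>k\<ge>(4 * T + 2) * (4 * T + 2). (nu x, nu x) \<in> R ^^ k"
    using relpow_eventually[OF a] by simp
  moreover have "(nu x, nu y) \<in> R\<^sup>*" "(nu y, nu x) \<in> R\<^sup>*"
    using xy(1)[OF k(1,2)] yx(1)[OF disj' k(1,2)] relpow_imp_rtrancl by blast+
  moreover have "(nu y, prod.swap (nu x)) \<in> R\<^sup>*" "(prod.swap (nu x), nu y) \<in> R\<^sup>*"
    using disjoint_windows(1)[OF y x' _ k(1,2)] disjoint_windows(1)[OF x' y _ k(1,2)] rev disj disj' swap
      relpow_imp_rtrancl by metis+
  ultimately show ?thesis unfolding flexible_def
    using xy(2,3)[OF k(1,2)] by (blast intro: rtrancl_trans)
qed

end

section \<open>Anchors in the presence of a loop\<close>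

lemma all_reflect:
  fixes e m :: int
  assumes "e = 1 \<or> e = -1" "\<And>j. \<bar>j\<bar> \<le> m \<Longrightarrow> Q' (e * j) = Q j"
  shows "(\<forall>j. \<bar>j\<bar> \<le> m \<longrightarrow> Q' j) \<longleftrightarrow> (\<forall>j. \<bar>j\<bar> \<le> m \<longrightarrow> Q j)"
proof -
  have "e * (e * j) = j" "\<bar>e * j\<bar> = \<bar>j\<bar>" for j using assms(1) by auto
  then show ?thesis using assms(2) by metis
qed

definition inside :: "int \<Rightarrow> (int \<Rightarrow> nat option) \<Rightarrow> int \<Rightarrow> bool" where
  "inside M w i \<longleftrightarrow> (\<forall>j. \<bar>j\<bar> \<le> M \<longrightarrow> w (i + j) \<noteq> None)"

lemma local_inside: "local_fun M (\<lambda>w i d. inside M w i)"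
  unfolding local_fun_def
proof (intro allI impI)
  fix w i w' i' e assume iso: "view_iso M w i w' i' e"
  then show "inside M w' i' = inside M w i" unfolding inside_def
    by (intro all_reflect[of e]) (auto simp: view_iso_def)
qed

lemma inside_path_ids:
  assumes "0 \<le> M"
  shows "inside M (path_ids n ids) i \<longleftrightarrow> M \<le> i \<and> i + M < int n"
proof
  assume *: "inside M (path_ids n ids) i"
  have "path_ids n ids (i + - M) \<noteq> None" "path_ids n ids (i + M) \<noteq> None"
    by (rule *[unfolded inside_def, rule_format], use assms in simp)+
  then show "M \<le> i \<and> i + M < int n" by (auto simp: path_ids_def split: if_splits)
qed (auto simp: inside_def path_ids_def)

lemma path_ids_inj:
  assumes "valid_ids c n ids" "0 \<le> i" "i < int n" "0 \<le> j" "j < int n"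
    "the (path_ids n ids i) = the (path_ids n ids j)"
  shows "i = j"
proof -
  have "ids (nat i) = ids (nat j)" using assms by (simp add: path_ids_def)
  then have "nat i = nat j" using assms by (auto simp: valid_ids_def dest: inj_onD)
  then show ?thesis using assms by simp
qed

section \<open>Pointers towards the largest nearby identifier\<close>

definition points :: "int \<Rightarrow> (int \<Rightarrow> nat option) \<Rightarrow> int \<Rightarrow> int \<Rightarrow> bool" where
  "points r w i d \<longleftrightarrow> (\<exists>p. 0 < p \<and> p \<le> r \<and> (\<forall>j. \<bar>j\<bar> \<le> r \<longrightarrow> the (w (i + d * j)) \<le> the (w (i + d * p))))"

definition local_max :: "int \<Rightarrow> (int \<Rightarrow> nat option) \<Rightarrow> int \<Rightarrow> bool" where
  "local_max r w i \<longleftrightarrow> (\<forall>j. \<bar>j\<bar> \<le> r \<longrightarrow> the (w (i + j)) \<le> the (w i))"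

definition constant_run :: "int \<Rightarrow> int \<Rightarrow> (int \<Rightarrow> nat option) \<Rightarrow> int \<Rightarrow> bool" where
  "constant_run r a w i \<longleftrightarrow> (\<exists>d. (d = 1 \<or> d = -1) \<and> (\<forall>j. \<bar>j\<bar> \<le> a \<longrightarrow> points r w (i + j) d))"

lemma local_points: "local_fun r (points r)"
  unfolding local_fun_def
proof (intro allI impI)
  fix w i w' i' e and d :: int assume iso: "view_iso r w i w' i' e" and d: "d = 1 \<or> d = -1"
  have "w' (i' + e * d * j) = w (i + d * j)" if "\<bar>j\<bar> \<le> r" for j
    using view_iso_at[OF iso, of "d * j"] that d by (auto simp: mult.assoc)
  then show "points r w' i' (e * d) = points r w i d"
    unfolding points_def by (intro ex_cong1 conj_cong all_cong) auto
qed

lemma local_constant_run: "local_fun (r + a) (\<lambda>w i d. constant_run r a w i)"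
  unfolding local_fun_def
proof (intro allI impI)
  fix w i w' i' e assume iso: "view_iso (r + a) w i w' i' e"
  have e: "e = 1 \<or> e = -1" using iso by (simp add: view_iso_def)
  have "(\<forall>j. \<bar>j\<bar> \<le> a \<longrightarrow> points r w' (i' + j) (e * d)) \<longleftrightarrow> (\<forall>j. \<bar>j\<bar> \<le> a \<longrightarrow> points r w (i + j) d)"
    if "d = 1 \<or> d = -1" for d
    using local_funD[OF local_points iso _ that] by (intro all_reflect[OF e]) simp
  from this[of 1] this[of "-1"] show "constant_run r a w' i' = constant_run r a w i"
    unfolding constant_run_def using e by auto
qed

text \<open>A step towards the maximum brings one new position into view, at the far end ahead. If
  its identifier is larger, the maximum is still ahead; otherwise the old maximum remains one, and
  it is ahead or, for p = 1, at the new node itself.\<close>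

lemma points_step:
  assumes d: "d = 1 \<or> d = -1" and p: "points r w i d"
  shows "points r w (i + d) d \<or> local_max r w (i + d)"
proof -
  obtain p where p: "0 < p" "p \<le> r"
    and le: "\<And>j. \<bar>j\<bar> \<le> r \<Longrightarrow> the (w (i + d * j)) \<le> the (w (i + d * p))"
    using p unfolding points_def by blast
  have shift: "i + d + d * j = i + d * (j + 1)" for j by (simp add: algebra_simps)
  have le': "the (w (i + d + d * j)) \<le> the (w (i + d * p))" if "\<bar>j\<bar> \<le> r" "j \<noteq> r" for j
    unfolding shift using that by (intro le) auto
  show ?thesis
  proof (cases "the (w (i + d + d * r)) \<le> the (w (i + d * p))")
    case False
    have "the (w (i + d + d * j)) \<le> the (w (i + d + d * r))" if "\<bar>j\<bar> \<le> r" for j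
      using le'[OF that] False by (cases "j = r") auto
    then have "points r w (i + d) d" unfolding points_def using p by (intro exI[of _ r]) auto
    then show ?thesis ..
  next
    case True
    then have all: "the (w (i + d + d * j)) \<le> the (w (i + d * p))" if "\<bar>j\<bar> \<le> r" for j
      using le'[OF that] by (cases "j = r") auto
    show ?thesis
    proof (cases "p = 1")
      case True
      have "the (w (i + d + j)) \<le> the (w (i + d))" if "\<bar>j\<bar> \<le> r" for j
      proof -
        have eq: "d * (d * j) = j" and le: "\<bar>d * j\<bar> \<le> r" using d that by auto
        show ?thesis using all[OF le] unfolding eq True by simp
      qed
      then show ?thesis by (simp add: local_max_def)
    next
      case False
      have "i + d * p = i + d + d * (p - 1)" by (simp add: algebra_simps)
      with all have "\<forall>j. \<bar>j\<bar> \<le> r \<longrightarrow> the (w (i + d + d * j)) \<le> the (w (i + d + d * (p - 1)))"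
        by metis
      moreover have "0 < p - 1" "p - 1 \<le> r" using p False by auto
      ultimately have "points r w (i + d) d" unfolding points_def by blast
      then show ?thesis ..
    qed
  qed
qed

lemma points_or_local_max:
  assumes "0 \<le> r"
  shows "points r w i 1 \<or> points r w i (-1) \<or> local_max r w i"
proof -
  let ?f = "\<lambda>j. the (w (i + j))"
  have fin: "finite (?f ` {-r..r})" "?f ` {-r..r} \<noteq> {}" using assms by auto
  obtain p where p: "p \<in> {-r..r}" "?f p = Max (?f ` {-r..r})"
    using Max_in[OF fin] by auto
  have le: "?f j \<le> ?f p" if "\<bar>j\<bar> \<le> r" for j
    unfolding p(2) using that fin by (intro Max_ge imageI) auto
  consider "p = 0" | "0 < p" | "p < 0" by linarith
  then show ?thesis
  proof cases
    case 1
    then show ?thesis using le by (simp add: local_max_def)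
  next
    case 2
    then show ?thesis using le p unfolding points_def by (intro disjI1 exI[of _ p]) auto
  next
    case 3
    have "?f (- j) \<le> ?f p" if "\<bar>j\<bar> \<le> r" for j using le[of "- j"] that by simp
    then have "points r w i (-1)" unfolding points_def using 3 p by (intro exI[of _ "- p"]) auto
    then show ?thesis by blast
  qed
qed

context
  fixes c n :: nat and ids :: "nat \<Rightarrow> nat" and w and r :: int
  assumes ids: "valid_ids c n ids" and w: "w = path_ids n ids" and r: "0 \<le> r"
begin

lemma points_exclusive:
  assumes "r \<le> i" "i + r < int n" "points r w i 1"
  shows "\<not> points r w i (-1)"
proof
  assume "points r w i (-1)"
  then obtain p' where p': "0 < p'" "p' \<le> r" "\<And>j. \<bar>j\<bar> \<le> r \<Longrightarrow> the (w (i - j)) \<le> the (w (i - p'))"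
    unfolding points_def by auto
  obtain p where p: "0 < p" "p \<le> r" "\<And>j. \<bar>j\<bar> \<le> r \<Longrightarrow> the (w (i + j)) \<le> the (w (i + p))"
    using assms unfolding points_def by auto
  have "the (w (i + p)) = the (w (i - p'))" using p(3)[of "- p'"] p'(3)[of "- p"] p p' by simp
  then have "i + p = i - p'" using assms p p' path_ids_inj[OF ids] unfolding w by simp
  then show False using p p' by simp
qed

lemma local_max_separated:
  assumes "r \<le> i" "i + r < int n" "r \<le> j" "j + r < int n" "local_max r w i" "local_max r w j" "i < j"
  shows "r < j - i"
proof (rule ccontr)
  assume near: "\<not> r < j - i"
  then have "the (w (i + (j - i))) \<le> the (w i)" "the (w (j + (i - j))) \<le> the (w j)"
    using assms(5)[unfolded local_max_def, rule_format, of "j - i"]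
      assms(6)[unfolded local_max_def, rule_format, of "i - j"] assms(7) by simp_all
  then have "the (w i) = the (w j)" by simp
  then show False using assms path_ids_inj[OF ids, of i j] r unfolding w by simp
qed

text \<open>Between two local maxima the pointers first point left and then right.\<close>

lemma ex_constant_run:
  assumes a: "0 \<le> a" "r = 4 * a + 1" and x: "r \<le> x" "x + 3 * r < int n"
  shows "\<exists>z. x \<le> z \<and> z \<le> x + 2 * r \<and> constant_run r a w z"
proof -
  \<comment> \<open>A stretch of r nodes without local maximum starts at x or right after a local
    maximum, since two of these are more than r apart.\<close>
  obtain y where y: "x \<le> y" "y \<le> x + r" "\<And>i. y \<le> i \<Longrightarrow> i < y + r \<Longrightarrow> \<not> local_max r w i"
  proof (cases "\<exists>m. x \<le> m \<and> m < x + r \<and> local_max r w m")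
    case True
    then obtain m where m: "x \<le> m" "m < x + r" "local_max r w m" by blast
    have "\<not> local_max r w i" if "m + 1 \<le> i" "i < m + 1 + r" for i
      using local_max_separated[of m i] m that x by auto
    then show ?thesis using that[of "m + 1"] m by simp
  qed (use that[of x] r in auto)
  \<comment> \<open>As r = 4a + 1, this is the centre of the stretch. The pointer of m persists for
    2a steps in its own direction, so a run of radius a is centred a steps ahead of m.\<close>
  define m where "m = y + 2 * a"
  have run: "points r w (m + d * int k) d" if d: "d = 1 \<or> d = -1" "points r w m d" and k: "int k \<le> 2 * a" for d k
    using k
  proof (induction k)
    case (Suc k)
    have "\<not> local_max r w (m + d * int k + d)"
      using Suc.prems d(1) a by (intro y(3)) (auto simp: m_def)
    then show ?case using points_step[OF d(1), of r w "m + d * int k"] Suc by (simp add: algebra_simps)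
  qed (use d in simp)
  have "\<not> local_max r w m" using y(3)[of m] a by (simp add: m_def)
  then obtain d where d: "d = 1 \<or> d = -1" "points r w m d" using points_or_local_max[OF r, of w m] by blast
  have "points r w (m + d * a + j) d" if j: "\<bar>j\<bar> \<le> a" for j
  proof -
    have eq: "m + d * int (nat (a + d * j)) = m + d * a + j" and le: "int (nat (a + d * j)) \<le> 2 * a"
      using d(1) j by (auto simp: algebra_simps)
    show ?thesis using run[OF d le] unfolding eq .
  qed
  then have "constant_run r a w (m + d * a)" using d(1) unfolding constant_run_def by blast
  moreover have "x \<le> m + d * a" "m + d * a \<le> x + 2 * r" using d(1) y a by (auto simp: m_def)
  ultimately show ?thesis by blast
qed

text \<open>Runs whose centres are at most 2a apart overlap and, pointers being unique, share their
  direction. Every node between the centres then also centres a run, so consecutive centres are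
  adjacent.\<close>

lemma constant_run_gap:
  assumes a: "0 \<le> a" and i: "a + r \<le> i1" "i2 + a + r < int n" "i1 < i2"
    and runs: "constant_run r a w i1" "constant_run r a w i2"
    and none: "\<And>i. i1 < i \<Longrightarrow> i < i2 \<Longrightarrow> \<not> constant_run r a w i"
  shows "2 * a < i2 - i1 \<or> i2 = i1 + 1 \<and> (points r w i1 1 \<longleftrightarrow> points r w i2 1)"
proof (rule disjCI)
  assume "\<not> (i2 = i1 + 1 \<and> (points r w i1 1 \<longleftrightarrow> points r w i2 1))"
  show "2 * a < i2 - i1"
  proof (rule ccontr)
    assume near: "\<not> 2 * a < i2 - i1"
    obtain d1 where d1: "d1 = 1 \<or> d1 = -1" "\<And>j. \<bar>j\<bar> \<le> a \<Longrightarrow> points r w (i1 + j) d1"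
      using runs(1) unfolding constant_run_def by blast
    obtain d2 where d2: "d2 = 1 \<or> d2 = -1" "\<And>j. \<bar>j\<bar> \<le> a \<Longrightarrow> points r w (i2 + j) d2"
      using runs(2) unfolding constant_run_def by blast
    have excl: "d = d'" if "r \<le> i" "i + r < int n" "points r w i d" "points r w i d'"
      "d = 1 \<or> d = -1" "d' = 1 \<or> d' = -1" for i d d'
      using points_exclusive[OF that(1,2)] that(3-6) by auto
    have "points r w (i1 + a) d1" "points r w (i1 + a) d2"
      using d1(2)[of a] d2(2)[of "i1 + a - i2"] a near i by auto
    then have dd: "d1 = d2" using excl[of "i1 + a" d1 d2] d1(1) d2(1) a i near r by auto
    have "i2 = i1 + 1"
    proof (rule ccontr)
      assume "i2 \<noteq> i1 + 1"
      then have lt: "i1 + 1 < i2" using i by simp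
      have "points r w (i1 + 1 + j) d1" if "\<bar>j\<bar> \<le> a" for j
      proof (cases "j < a")
        case True
        then show ?thesis using d1(2)[of "1 + j"] that by (simp add: add.assoc)
      next
        case False
        then have le: "\<bar>i1 + 1 + j - i2\<bar> \<le> a" using that lt near by linarith
        have eq: "i2 + (i1 + 1 + j - i2) = i1 + 1 + j" by simp
        show ?thesis using d2(2)[OF le] unfolding eq dd .
      qed
      then have "constant_run r a w (i1 + 1)" using d1(1) unfolding constant_run_def by blast
      then show False using none[of "i1 + 1"] lt by simp
    qed
    moreover have "points r w i1 d1" "points r w i2 d1"
      using d1(2)[of 0] d2(2)[of 0] a unfolding dd by auto
    then have "points r w i1 1 \<longleftrightarrow> points r w i2 1"
      using excl[of i1 d1 1] excl[of i2 d1 1] d1(1) i a r by auto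
    ultimately show False using \<open>\<not> (i2 = i1 + 1 \<and> _)\<close> by blast
  qed
qed

end

context terminal_walks
begin

lemma solvable_of_loop:
  assumes loop: "(q, q) \<in> R"
  shows "\<exists>T. \<forall>n\<ge>K + 2. \<forall>N. \<forall>T'\<ge>T. solvable_in_rounds c (restricted h N) n T'"
proof -
  \<comment> \<open>Gaps of more than one step exceed 2a \<ge> K. The margin M = a + r keeps every
    position consulted by \<open>J\<close> on the path; no constant depends on n.\<close>
  define a where "a = K + 1"
  define r where "r = 4 * a + 1"
  define M where "M = a + r"
  define J where "J w i \<longleftrightarrow> inside (int M) w i \<and> constant_run (int r) (int a) w i" for w i
  have "solvable_in_rounds c (restricted h N) n T'"
    if n: "K + 2 \<le> n" and T': "3 * M + 2 * r + 3 \<le> T'" for n N T'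
  proof (rule solvable_of_anchors[where J = J and Or = "points (int r)"])
    have "int r + int a \<le> int M" by (simp add: M_def)
    then have "local_fun (int M) (\<lambda>w i d. constant_run (int r) (int a) w i)"
      by (rule local_fun_mono[OF local_constant_run])
    then show "local_fun (int M) (\<lambda>w i d. J w i)"
      using local_inside[of "int M"] unfolding J_def by (simp add: local_fun_def)
    show "local_fun (int M) (points (int r))"
      by (rule local_fun_mono[OF local_points]) (simp add: M_def)
    show "K \<le> M" "0 < M" by (auto simp: M_def a_def)
    show "K + 2 \<le> n" by (rule n)
    show "2 * M + 2 * r + M + 3 \<le> T'" using T' by simp
  next
    fix ids w i assume ids: "valid_ids c n ids" "w = path_ids n ids" and J: "J w i"
    have in_path: "int M \<le> i" "i + int M < int n"
      using J ids(2) inside_path_ids[of "int M"] by (auto simp: J_def)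
    then have safe: "int r \<le> i" "i + int r < int n" by (auto simp: M_def)
    obtain d where "d = 1 \<or> d = -1" "\<And>j. \<bar>j\<bar> \<le> int a \<Longrightarrow> points (int r) w (i + j) d"
      using J unfolding J_def constant_run_def by blast
    from this(1) this(2)[of 0] have "points (int r) w i 1 \<or> points (int r) w i (-1)" by auto
    then show "int M \<le> i \<and> i + int M < int n \<and> (points (int r) w i (-1) \<longleftrightarrow> \<not> points (int r) w i 1)"
      using in_path points_exclusive[OF ids _ safe] by auto
  next
    fix ids w i1 i2
    assume ids: "valid_ids c n ids" "w = path_ids n ids" and J: "J w i1" "J w i2" "i1 < i2"
      and none: "\<And>i. i1 < i \<Longrightarrow> i < i2 \<Longrightarrow> \<not> J w i"
    have in_path: "int M \<le> i1" "i2 + int M < int n"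
      using J ids(2) inside_path_ids[of "int M"] by (auto simp: J_def)
    have "\<not> constant_run (int r) (int a) w i" if "i1 < i" "i < i2" for i
      using none[OF that] in_path that ids(2) inside_path_ids[of "int M" n ids i] by (auto simp: J_def)
    then have "2 * int a < i2 - i1 \<or> i2 = i1 + 1 \<and> (points (int r) w i1 1 \<longleftrightarrow> points (int r) w i2 1)"
      using constant_run_gap[OF ids, of "int r" "int a" i1 i2] J in_path by (auto simp: J_def M_def)
    then show "int K \<le> i2 - i1 \<or> i2 = i1 + 1 \<and> (points (int r) w i1 1 \<longleftrightarrow> points (int r) w i2 1) \<and> (q, q) \<in> R"
      using loop by (auto simp: a_def)
  next
    fix ids w i
    assume ids: "valid_ids c n ids" "w = path_ids n ids" and i: "int M \<le> i" "i + int (2 * r) + int M < int n"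
    obtain z where "i \<le> z" "z \<le> i + 2 * int r" "constant_run (int r) (int a) w z"
      using ex_constant_run[OF ids, of "int r" "int a" i] i by (auto simp: r_def M_def)
    then show "\<exists>j\<ge>i. j \<le> i + int (2 * r) \<and> J w j"
      using i ids(2) inside_path_ids[of "int M"] by (intro exI[of _ z]) (auto simp: J_def)
  qed
  then show ?thesis by blast
qed

end

section \<open>Anchors without loops\<close>

text \<open>A rule that separates any two adjacent windows is applied to the subpaths of stride k. The two
  neighbours are recorded together with the order of the identifiers, since the path has no common
  orientation.\<close>

definition hue :: "((int \<Rightarrow> nat) \<Rightarrow> 'b) \<Rightarrow> nat \<Rightarrow> (int \<Rightarrow> nat option) \<Rightarrow> int \<Rightarrow> ('b \<times> bool) set" where
  "hue nu k w i =
    (\<lambda>d. (nu (\<lambda>j. the (w (i + d * (int k * j)))), the (w i) < the (w (i + d * int k)))) ` {1, -1}"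

definition hues :: "((int \<Rightarrow> nat) \<Rightarrow> 'b) \<Rightarrow> nat \<Rightarrow> (int \<Rightarrow> nat option) \<Rightarrow> int \<Rightarrow> ('b \<times> bool) set list" where
  "hues nu K w i = map (\<lambda>k. hue nu k w i) [1..<Suc K]"

text \<open>The radius covers both the T strides of the window and the single stride of the
  comparison, also for T = 0.\<close>

lemma local_hue:
  assumes nu: "\<And>x y. (\<And>j. \<bar>j\<bar> \<le> int T \<Longrightarrow> x j = y j) \<Longrightarrow> nu x = nu y"
  shows "local_fun (int (k * Suc T)) (\<lambda>w i d. hue nu k w i)"
  unfolding local_fun_def
proof (intro allI impI)
  fix w i w' i' e assume iso: "view_iso (int (k * Suc T)) w i w' i' e"
  have e: "e = 1 \<or> e = -1" using iso by (simp add: view_iso_def)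
  let ?g = "\<lambda>w i d. (nu (\<lambda>j. the (w (i + d * (int k * j)))), the (w i) < the (w (i + d * int k)))"
  have "?g w' i' (e * d) = ?g w i d" if d: "d = 1 \<or> d = -1" for d
  proof -
    have eq: "w' (i' + e * d * m) = w (i + d * m)" if "\<bar>m\<bar> \<le> int (k * Suc T)" for m
      using view_iso_at[OF iso, of "d * m"] that d by (auto simp: mult.assoc)
    have "nu (\<lambda>j. the (w' (i' + e * d * (int k * j)))) = nu (\<lambda>j. the (w (i + d * (int k * j))))"
    proof (rule nu)
      fix j :: int assume "\<bar>j\<bar> \<le> int T"
      then have "int k * \<bar>j\<bar> \<le> int k * int (Suc T)" by (intro mult_left_mono) auto
      then have "\<bar>int k * j\<bar> \<le> int (k * Suc T)" by (simp add: abs_mult algebra_simps)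
      then show "the (w' (i' + e * d * (int k * j))) = the (w (i + d * (int k * j)))" using eq by simp
    qed
    moreover have "w' (i' + e * d * int k) = w (i + d * int k)" "w' i' = w i"
      using eq[of "int k"] eq[of 0] by auto
    ultimately show ?thesis by simp
  qed
  from this[of 1] this[of "-1"] have "?g w' i' ` {1, -1} = ?g w i ` {1, -1}" using e by auto
  then show "hue nu k w' i' = hue nu k w i" unfolding hue_def .
qed

lemma local_hues:
  assumes nu: "\<And>x y. (\<And>j. \<bar>j\<bar> \<le> int T \<Longrightarrow> x j = y j) \<Longrightarrow> nu x = nu y"
  shows "local_fun (int (K * Suc T)) (\<lambda>w i d. hues nu K w i)"
  unfolding local_fun_def
proof (intro allI impI)
  fix w i w' i' e and d :: int
  assume iso: "view_iso (int (K * Suc T)) w i w' i' e" and d: "d = 1 \<or> d = -1"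
  have "hue nu k w' i' = hue nu k w i" if "k \<in> set [1..<Suc K]" for k
  proof -
    have "k * Suc T \<le> K * Suc T" using that by (intro mult_right_mono) auto
    then have "local_fun (int (K * Suc T)) (\<lambda>w i d. hue nu k w i)"
      by (intro local_fun_mono[OF local_hue[OF nu]]) (simp_all only: of_nat_le_iff)
    then show ?thesis using iso d unfolding local_fun_def by blast
  qed
  then show "hues nu K w' i' = hues nu K w i" unfolding hues_def by (intro map_cong) auto
qed

text \<open>Seen from i + k, the record in the direction back to i carries the opposite order of the
  same two identifiers. Equal hues would thus match the two windows read in the same direction,
  which are adjacent on the subpath of stride k.\<close>

lemma hue_proper:
  assumes ids: "valid_ids c n ids" and w: "w = path_ids n ids"
    and nu: "\<And>x. inj_on x {- int T..int T + 1} \<Longrightarrow> x ` {- int T..int T + 1} \<subseteq> {1..n ^ c} \<Longrightarrow>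
      nu x \<noteq> nu (\<lambda>j. x (j + 1))"
    and k: "0 < k" and i: "int (k * T) \<le> i" "i + int (k * Suc T) < int n"
  shows "hue nu k w i \<noteq> hue nu k w (i + int k)"
proof
  assume eq: "hue nu k w i = hue nu k w (i + int k)"
  define x where "x j = the (w (i + int k * j))" for j
  have pos: "0 \<le> i + int k * j \<and> i + int k * j < int n" if "j \<in> {- int T..int T + 1}" for j
  proof -
    have "int k * (- int T) \<le> int k * j" by (rule mult_left_mono) (use that in auto)
    moreover have "int k * j \<le> int k * int (Suc T)" by (rule mult_left_mono) (use that in auto)
    ultimately show ?thesis using i by (simp add: algebra_simps)
  qed
  have "inj_on x {- int T..int T + 1}"
  proof (rule inj_onI)
    fix j j' assume j: "j \<in> {- int T..int T + 1}" "j' \<in> {- int T..int T + 1}" "x j = x j'"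
    have "i + int k * j = i + int k * j'"
      using path_ids_inj[OF ids, of "i + int k * j" "i + int k * j'"] pos[OF j(1)] pos[OF j(2)] j(3)
      unfolding x_def w by blast
    then show "j = j'" using k by simp
  qed
  moreover have "x j \<in> {1..n ^ c}" if "j \<in> {- int T..int T + 1}" for j
  proof -
    have "nat (i + int k * j) < n" using pos[OF that] by linarith
    then have "ids (nat (i + int k * j)) \<in> {1..n ^ c}" using ids unfolding valid_ids_def by blast
    then show ?thesis using pos[OF that] unfolding x_def w path_ids_def by simp
  qed
  ultimately have ne: "nu x \<noteq> nu (\<lambda>j. x (j + 1))" by (intro nu) auto
  have "the (w i) \<noteq> the (w (i + int k))"
    using path_ids_inj[OF ids, of i "i + int k"] pos[of 0] pos[of 1] k unfolding w by auto
  then have less: "(the (w i) < the (w (i + int k))) \<noteq> (the (w (i + int k)) < the (w i))"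
    by linarith
  have "(nu x, the (w i) < the (w (i + int k))) \<in> hue nu k w i"
    unfolding hue_def x_def by (intro image_eqI[of _ _ 1]) auto
  then have "(nu x, the (w i) < the (w (i + int k))) \<in> hue nu k w (i + int k)" using eq by simp
  \<comment> \<open>For T = 0 the position i + 2k may lie beyond the path; it affects only the order
    bit of this record, which is discarded here.\<close>
  then have "nu x = nu (\<lambda>j. the (w (i + int k + 1 * (int k * j))))" using less unfolding hue_def by auto
  also have "(\<lambda>j. the (w (i + int k + 1 * (int k * j)))) = (\<lambda>j. x (j + 1))"
    unfolding x_def by (simp add: algebra_simps)
  finally show False using ne by blast
qed

section \<open>Greedy independent sets from a proper colouring\<close>

primrec greedy :: "((int \<Rightarrow> nat option) \<Rightarrow> int \<Rightarrow> nat) \<Rightarrow> nat \<Rightarrow> nat \<Rightarrow> nat \<Rightarrow> (int \<Rightarrow> nat option) \<Rightarrow> int \<Rightarrow> bool" where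
  "greedy col M K 0 w i = False"
| "greedy col M K (Suc t) w i = (greedy col M K t w i \<or>
     inside (int M) w i \<and> col w i = t \<and> (\<forall>j. \<bar>j\<bar> \<le> int K \<longrightarrow> \<not> greedy col M K t w (i + j)))"

lemma local_greedy:
  assumes col: "local_fun (int M) (\<lambda>w i d. col w i)"
  shows "local_fun (int (M + t * K)) (\<lambda>w i d. greedy col M K t w i)"
proof (induction t)
  case (Suc t)
  show ?case unfolding local_fun_def
  proof (intro allI impI)
    fix w i w' i' e and d :: int
    assume iso: "view_iso (int (M + Suc t * K)) w i w' i' e" and d: "d = 1 \<or> d = -1"
    have e: "e = 1 \<or> e = -1" using iso by (simp add: view_iso_def)
    have at: "greedy col M K t w' (i' + e * j) = greedy col M K t w (i + j)" if "\<bar>j\<bar> \<le> int K" for j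
      using local_funD[OF Suc iso _ d, of j] that by simp
    have "inside (int M) w' i' = inside (int M) w i" "col w' i' = col w i"
      using local_funD[OF local_inside iso _ d, of 0] local_funD[OF col iso _ d, of 0] by simp_all
    moreover have "(\<forall>j. \<bar>j\<bar> \<le> int K \<longrightarrow> \<not> greedy col M K t w' (i' + j)) \<longleftrightarrow>
        (\<forall>j. \<bar>j\<bar> \<le> int K \<longrightarrow> \<not> greedy col M K t w (i + j))"
      using at by (intro all_reflect[OF e]) simp
    ultimately show "greedy col M K (Suc t) w' i' = greedy col M K (Suc t) w i"
      using at[of 0] by simp
  qed
qed (simp add: local_fun_def)

lemma greedy_inside: "greedy col M K t w i \<Longrightarrow> inside (int M) w i"
  by (induction t) auto

text \<open>Nodes joining in the same round have equal colours and are far apart by properness; a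
  node joining later was checked against all earlier ones.\<close>

lemma greedy_independent:
  assumes col: "\<And>i i'. \<lbrakk>inside (int M) w i; inside (int M) w i'; i < i'; i' - i \<le> int K\<rbrakk> \<Longrightarrow> col w i \<noteq> col w i'"
  shows "greedy col M K t w i \<Longrightarrow> greedy col M K t w i' \<Longrightarrow> i < i' \<Longrightarrow> int K < i' - i"
proof (induction t)
  case (Suc t)
  show ?case
  proof (rule ccontr)
    assume near: "\<not> int K < i' - i"
    have "\<not> (greedy col M K t w i \<and> greedy col M K t w i')" using Suc near by blast
    then consider "inside (int M) w i" "inside (int M) w i'" "col w i = t" "col w i' = t"
      | "greedy col M K t w i" "\<forall>j. \<bar>j\<bar> \<le> int K \<longrightarrow> \<not> greedy col M K t w (i' + j)"
      | "greedy col M K t w i'" "\<forall>j. \<bar>j\<bar> \<le> int K \<longrightarrow> \<not> greedy col M K t w (i + j)"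
      using Suc.prems by auto
    then show False
    proof cases
      case 1
      then show ?thesis using col[of i i'] Suc.prems near by simp
    next
      case 2
      then show ?thesis using spec[OF 2(2), of "i - i'"] Suc.prems near by simp
    next
      case 3
      then show ?thesis using spec[OF 3(2), of "i' - i"] Suc.prems near by simp
    qed
  qed
qed simp

lemma greedy_mono: "greedy col M K t w i \<Longrightarrow> t \<le> m \<Longrightarrow> greedy col M K m w i"
  by (induction m) (auto simp: le_Suc_eq)

lemma greedy_maximal:
  assumes "inside (int M) w i" "col w i < m"
  shows "\<exists>j. \<bar>j\<bar> \<le> int K \<and> greedy col M K m w (i + j)"
proof (cases "\<exists>j. \<bar>j\<bar> \<le> int K \<and> greedy col M K (col w i) w (i + j)")
  case True
  then show ?thesis using greedy_mono[of col M K "col w i" w _ m] assms by (meson less_imp_le)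
next
  case False
  then have "greedy col M K (Suc (col w i)) w i" using assms by auto
  then have "greedy col M K m w (i + 0)" using greedy_mono[of col M K "Suc (col w i)" w i m] assms by simp
  then show ?thesis by (intro exI[of _ 0]) auto
qed

context terminal_walks
begin

text \<open>C serves all algorithms and sizes at once, because the number of colours depends only on
  K and the finite label set while the colouring radius is linear in T.\<close>

lemma solvable_of_loop_free:
  assumes loop_free: "\<And>e. flexible e \<Longrightarrow> (e, e) \<notin> R"
  shows "\<exists>C. \<forall>A n T. fast_algorithm Cedge Cnode S A n T c \<and> K + 2 \<le> n \<longrightarrow>
    (\<forall>N. solvable_in_rounds c (restricted h N) n (C * Suc T))"
proof -
  \<comment> \<open>The successor keeps the number of strides, and with it the margin M, positive
    even if K = 0.\<close>
  define k where "k = Suc K"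
  define P where "P = {l :: (('g \<times> 'g) \<times> bool) set list. set l \<subseteq> UNIV \<and> length l = k}"
  have "finite P" unfolding P_def by (intro finite_lists_length_eq) simp
  then obtain f and m :: nat where f: "f ` P = {i. i < m}" "inj_on f P"
    using finite_imp_inj_to_nat_seg by blast
  have "solvable_in_rounds c (restricted h N) n ((3 * k + 2 * k + 3 + m * k) * Suc T)"
    if A: "fast_algorithm Cedge Cnode S A n T c" and Kn: "K + 2 \<le> n" for A n T N
  proof -
    interpret fast_algorithm Cedge Cnode S A n T c by (rule A)
    define M where "M = k * Suc T"
    define col where "col w i = f (hues nu k w i)" for w i
    define J where "J = greedy col M k m"
    \<comment> \<open>Each anchor is directed towards its neighbour with the larger identifier.
      Different anchors need not agree, as every gap is long enough for a walk between any two
      states of \<open>D\<close>.\<close>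
    define Or where "Or w i d \<longleftrightarrow> the (w (i - d)) < the (w (i + d))" for w :: "int \<Rightarrow> nat option" and i d :: int
    have M: "0 < M" "K \<le> M" by (auto simp: M_def k_def)
    have hues: "length (hues nu k w i) = k" for w i by (simp add: hues_def)
    have col_less: "col w i < m" for w i using f(1) hues unfolding col_def P_def by blast
    have "local_fun (int M) (\<lambda>w i d. hues nu k w i)"
      unfolding M_def nu_def by (intro local_hues window_output_cong) simp
    then have local_col: "local_fun (int M) (\<lambda>w i d. col w i)"
      unfolding col_def by (simp add: local_fun_def)
    have proper: "col w i \<noteq> col w i'"
      if ids: "valid_ids c n ids" "w = path_ids n ids" and i: "inside (int M) w i" "inside (int M) w i'" "i < i'" "i' - i \<le> int k"
      for ids w i i'
    proof
      assume "col w i = col w i'"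
      then have eq: "hues nu k w i = hues nu k w i'"
        using f(2) hues unfolding col_def P_def by (auto dest: inj_onD)
      define l where "l = nat (i' - i)"
      have l: "0 < l" "l \<le> k" "i' = i + int l" using i by (auto simp: l_def)
      have "l * T \<le> M" "l * Suc T \<le> M" unfolding M_def by (rule mult_le_mono; use l in simp)+
      moreover have "int M \<le> i" "i + int M < int n" using i ids(2) inside_path_ids[of "int M"] by auto
      ultimately have range: "int (l * T) \<le> i" "i + int (l * Suc T) < int n" by linarith+
      have "l \<in> set [1..<Suc k]" using l by auto
      with eq have "hue nu l w i = hue nu l w (i + int l)"
        using l unfolding hues_def map_eq_conv by blast
      moreover have "hue nu l w i \<noteq> hue nu l w (i + int l)"
      proof (rule hue_proper[OF ids _ l(1) range])
        fix x assume x: "inj_on x {- int T..int T + 1}" "x ` {- int T..int T + 1} \<subseteq> {1..n ^ c}"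
        then have "window {- int T..int T} x" unfolding window_def by (auto elim: inj_on_subset)
        then have "flexible (nu x)" by (rule flexible_window)
        then have "(nu x, nu x) \<notin> R" by (rule loop_free)
        moreover have "(nu x, nu (\<lambda>j. x (j + 1))) \<in> R"
          using x by (intro adjacent_windows) (simp add: window_def)
        \<comment> \<open>Equal outputs at adjacent nodes would form a loop at a flexible
          state.\<close>
        ultimately show "nu x \<noteq> nu (\<lambda>j. x (j + 1))" by metis
      qed
      ultimately show False by blast
    qed
    show ?thesis
    proof (rule solvable_of_anchors[where J = J and Or = Or])
      show "local_fun (int (M + m * k)) (\<lambda>w i d. J w i)"
        unfolding J_def by (rule local_greedy[OF local_col])
      have "local_fun 1 Or" unfolding local_fun_def
      proof (intro allI impI)
        fix w i w' i' e and d :: int assume iso: "view_iso 1 w i w' i' e" and d: "d = 1 \<or> d = -1"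
        have "w' (i' + e * d) = w (i + d)" "w' (i' - e * d) = w (i - d)"
          using view_iso_at[OF iso, of d] view_iso_at[OF iso, of "- d"] d by auto
        then show "Or w' i' (e * d) = Or w i d" unfolding Or_def by simp
      qed
      then show "local_fun (int (M + m * k)) Or" by (rule local_fun_mono) (use M in linarith)
      show "K \<le> M" "0 < M" "K + 2 \<le> n" using M Kn by auto
      show "2 * M + 2 * k + (M + m * k) + 3 \<le> (3 * k + 2 * k + 3 + m * k) * Suc T"
        unfolding M_def by (simp add: algebra_simps)
    next
      fix ids w i assume ids: "valid_ids c n ids" "w = path_ids n ids" and J: "J w i"
      have i: "int M \<le> i" "i + int M < int n"
        using greedy_inside[of col M k m w i] J ids(2) inside_path_ids[of "int M"] unfolding J_def by auto
      have "the (w (i - 1)) \<noteq> the (w (i + 1))"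
        using path_ids_inj[OF ids(1), of "i - 1" "i + 1"] i M unfolding ids(2) by auto
      then show "int M \<le> i \<and> i + int M < int n \<and> (Or w i (-1) \<longleftrightarrow> \<not> Or w i 1)"
        using i unfolding Or_def by auto
    next
      fix ids w i1 i2
      assume ids: "valid_ids c n ids" "w = path_ids n ids" and J: "J w i1" "J w i2" "i1 < i2"
      have "int k < i2 - i1"
        using greedy_independent[where col = col and M = M and w = w and K = k and t = m, OF proper[OF ids]] J
        unfolding J_def by blast
      then show "int K \<le> i2 - i1 \<or> i2 = i1 + 1 \<and> (Or w i1 1 \<longleftrightarrow> Or w i2 1) \<and> (q, q) \<in> R"
        by (simp add: k_def)
    next
      fix ids w i
      assume ids: "valid_ids c n ids" "w = path_ids n ids" and i: "int M \<le> i" "i + int (2 * k) + int M < int n"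
      have "inside (int M) w (i + int k)" using i ids(2) inside_path_ids[of "int M"] by auto
      then obtain j where "\<bar>j\<bar> \<le> int k" "J w (i + int k + j)"
        using greedy_maximal[of M w "i + int k" col m k] col_less unfolding J_def by blast
      then show "\<exists>j\<ge>i. j \<le> i + int (2 * k) \<and> J w j" by (intro exI[of _ "i + int k + j"]) auto
    qed
  qed
  then show ?thesis by blast
qed

end

section \<open>Comparison of the round complexities\<close>

lemma log_star_le: "log_star n \<le> n"
proof (induction n rule: less_induct)
  case (less n)
  show ?case
  proof (cases "n \<le> 1")
    case False
    have "real n < 2 powr real n"
      by (metis of_nat_less_two_power powr_realpow zero_less_numeral of_nat_numeral)
    then have "log 2 (real n) < real n" using False by (subst log_less_iff) auto
    then have "nat \<lfloor>log 2 (real n)\<rfloor> < n" using False by linarith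
    then show ?thesis using less[of "nat \<lfloor>log 2 (real n)\<rfloor>"] by (subst log_star.simps) auto
  qed (simp add: log_star.simps)
qed

lemma log_star_le_log: "2 \<le> n \<Longrightarrow> real (log_star n) \<le> 1 + log 2 (real n)"
proof -
  assume n: "2 \<le> n"
  then have "0 \<le> log 2 (real n)" by simp
  then have "real (log_star (nat \<lfloor>log 2 (real n)\<rfloor>)) \<le> log 2 (real n)"
    using log_star_le[of "nat \<lfloor>log 2 (real n)\<rfloor>"] by linarith
  then show ?thesis using n by (subst log_star.simps) auto
qed

lemma eventually_log_star_small:
  fixes T :: "nat \<Rightarrow> nat" and C :: nat
  assumes "(\<lambda>n. real (T n)) \<in> O(\<lambda>n. real (log_star n))"
  shows "\<exists>N. \<forall>n\<ge>N. C * Suc (T n) \<le> n"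
proof -
  have "(\<lambda>n. real (log_star n)) \<in> O(\<lambda>n. 1 + log 2 (real n))"
    by (intro bigoI[of _ 1] eventually_sequentiallyI[of 2]) (use log_star_le_log in force)
  then have "(\<lambda>n. real (T n)) \<in> O(\<lambda>n. 1 + log 2 (real n))" using assms landau_o.big_trans by blast
  also have "(\<lambda>n. 1 + log 2 (real n)) \<in> o(\<lambda>n. real n)" by real_asymp
  finally have "(\<lambda>n. real (T n)) \<in> o(\<lambda>n. real n)" .
  moreover have "(\<lambda>n. 1 :: real) \<in> o(\<lambda>n. real n)" by real_asymp
  ultimately have "(\<lambda>n. real (T n) + 1) \<in> o(\<lambda>n. real n)" by (rule sum_in_smallo)
  then have "(\<lambda>n. real C * (real (T n) + 1)) \<in> o(\<lambda>n. real n)" by simp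
  from landau_o.smallD[OF this, of 1]
  have "eventually (\<lambda>n. real C * (real (T n) + 1) \<le> real n) at_top"
    by (auto elim!: eventually_mono)
  then obtain N where "\<And>n. n \<ge> N \<Longrightarrow> real C * (real (T n) + 1) \<le> real n"
    by (auto simp: eventually_sequentially)
  then have "C * Suc (T n) \<le> n" if "n \<ge> N" for n
  proof -
    have "real (C * Suc (T n)) \<le> real n" using \<open>n \<ge> N \<Longrightarrow> _\<close>[OF that] by (simp add: algebra_simps)
    then show ?thesis by linarith
  qed
  then show ?thesis by blast
qed

lemma solvable_round_complexity:
  "solvable_in_rounds c P n T \<Longrightarrow> solvable_in_rounds c P n (round_complexity c P n) \<and> round_complexity c P n \<le> T"
  unfolding round_complexity_def by (blast intro: LeastI Least_le)

lemma solvable_in_rounds_mono: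
  "solvable_in_rounds c P n T \<Longrightarrow> (\<And>L. P n L \<Longrightarrow> P' n L) \<Longrightarrow> solvable_in_rounds c P' n T"
  unfolding solvable_in_rounds_def by blast

context terminal_walks
begin

text \<open>Solutions of the restriction solve \<open>P\<close>, which bounds its complexity from
  below; from above, \<open>fast\<close> covers the large n, and up to N the two problems
  coincide.\<close>

lemma mendable_restriction:
  fixes T :: "nat \<Rightarrow> nat" and c C N0 :: nat
  defines "P \<equiv> necl_solution Cedge Cnode S S"
  assumes c: "1 \<le> c" and T: "\<And>n. solvable_in_rounds c P n (T n)"
    and fast: "\<And>n N. N0 \<le> n \<Longrightarrow> solvable_in_rounds c (restricted h N) n (C * Suc (round_complexity c P n))"
  shows "\<exists>(r0 :: nat) (psi0 :: ('g \<times> 'g) list \<Rightarrow> nat \<Rightarrow> bool).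
           orientation_invariant psi0 \<and>
           (\<forall>n. \<exists>T. solvable_in_rounds c (lcl_solution r0 psi0) n T) \<and>
           (\<lambda>n. real (round_complexity c (lcl_solution r0 psi0) n) + 1)
             \<in> \<Theta>(\<lambda>n. real (round_complexity c P n) + 1) \<and>
           (\<forall>n L. lcl_solution r0 psi0 n L \<longrightarrow> P n L) \<and>
           O1_mendable r0 psi0"
proof -
  \<comment> \<open>N \<ge> N0 confines the extra demand to sizes where \<open>fast\<close> applies,
    and N > K leaves room for a walk between the two ends.\<close>
  define N where "N = N0 + K + 1"
  define r where "r = N + h"
  let ?psi = "verifier r h N"
  have r: "h \<le> r" "N \<le> r" "0 < N" "K < N" by (auto simp: r_def N_def)
  have lcl: "lcl_solution r ?psi = restricted h N"
    by (intro ext) (rule lcl_solution_verifier[OF h_pos r(1,2)])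
  have small: "restricted h N n L \<longleftrightarrow> P n L" if "n \<le> N" for n L
    using that by (simp add: restricted_def P_def)
  define R0 where "R0 = round_complexity c P"
  define R1 where "R1 = round_complexity c (restricted h N)"
  have R0: "solvable_in_rounds c P n (R0 n)" for n
    using solvable_round_complexity[OF T] unfolding R0_def by blast
  have upper: "\<exists>T. solvable_in_rounds c (restricted h N) n T \<and> T \<le> Suc C * Suc (R0 n)" for n
  proof (cases "n \<le> N")
    case True
    then have "solvable_in_rounds c (restricted h N) n (R0 n)"
      using solvable_in_rounds_mono[OF R0, of n "restricted h N"] small by blast
    then show ?thesis by (intro exI[of _ "R0 n"]) simp
  next
    case False
    then have "solvable_in_rounds c (restricted h N) n (C * Suc (R0 n))"
      unfolding R0_def by (intro fast) (simp add: N_def)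
    then show ?thesis by (intro exI[of _ "C * Suc (R0 n)"]) simp
  qed
  then have R1: "solvable_in_rounds c (restricted h N) n (R1 n)" "R1 n \<le> Suc C * Suc (R0 n)" for n
    using solvable_round_complexity le_trans unfolding R1_def by blast+
  have "solvable_in_rounds c P n (R1 n)" for n
    by (rule solvable_in_rounds_mono[OF R1(1)]) (simp add: restricted_def P_def)
  then have lower: "R0 n \<le> R1 n" for n
    using solvable_round_complexity unfolding R0_def by blast
  have "(\<lambda>n. real (R1 n) + 1) \<in> O(\<lambda>n. real (R0 n) + 1)"
  proof (rule bigoI[of _ "real (Suc C) + 1"], rule always_eventually, rule allI)
    fix n
    have "R1 n + 1 \<le> (Suc C + 1) * (R0 n + 1)" using R1(2)[of n] by simp
    then have "real (R1 n + 1) \<le> real ((Suc C + 1) * (R0 n + 1))" by (simp only: of_nat_le_iff)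
    then show "norm (real (R1 n) + 1) \<le> (real (Suc C) + 1) * norm (real (R0 n) + 1)" by (simp add: algebra_simps)
  qed
  moreover have "(\<lambda>n. real (R0 n) + 1) \<in> O(\<lambda>n. real (R1 n) + 1)"
    by (rule bigoI[of _ 1]) (simp add: lower)
  ultimately have theta: "(\<lambda>n. real (R1 n) + 1) \<in> \<Theta>(\<lambda>n. real (R0 n) + 1)"
    by (simp add: bigtheta_def bigomega_iff_bigo)
  \<comment> \<open>Mending a short path presupposes a solution; running the algorithm on the
    identifiers 1, ..., n produces one.\<close>
  have "\<exists>L. restricted h N n L" if "n \<le> N" for n
  proof -
    have "n \<le> n ^ c" using c by (cases "n = 0") (auto intro: self_le_power)
    then have "valid_ids c n Suc" by (auto simp: valid_ids_def)
    then have "\<exists>L. P n L" using R0[of n] unfolding solvable_in_rounds_def by blast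
    then show ?thesis using small[OF that] by blast
  qed
  then have "O1_mendable r ?psi" by (rule O1_mendable_verifier[OF r])
  moreover have "\<forall>n L. restricted h N n L \<longrightarrow> P n L" by (simp add: restricted_def P_def)
  ultimately show ?thesis
    using orientation_invariant_verifier[OF h_pos, of r N] R1(1) theta unfolding R0_def R1_def
    by (intro exI[of _ r] exI[of _ ?psi]) (auto simp: lcl)
qed

end

section \<open>Choice of the component and conclusion\<close>

context sym_lcl
begin

lemma ex_flexible:
  assumes "fast_algorithm Cedge Cnode S A n T c"
  shows "\<exists>q. flexible q"
proof -
  interpret fast_algorithm Cedge Cnode S A n T c by (rule assms)
  let ?x = "\<lambda>j. nat (j + int T + 1)"
  have "window {- int T..int T} ?x"
    unfolding window_def inj_on_def using n n_le by auto
  then show ?thesis using flexible_window by blast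
qed

lemma ex_mendable_restriction:
  fixes T :: "nat \<Rightarrow> nat" and c :: nat
  defines "P \<equiv> necl_solution Cedge Cnode S S"
  assumes c: "1 \<le> c" and T: "\<And>n. solvable_in_rounds c P n (T n)"
    and small: "(\<lambda>n. real (T n)) \<in> O(\<lambda>n. real (log_star n))"
  shows "\<exists>(r0 :: nat) (psi0 :: ('g \<times> 'g) list \<Rightarrow> nat \<Rightarrow> bool).
           orientation_invariant psi0 \<and>
           (\<forall>n. \<exists>T. solvable_in_rounds c (lcl_solution r0 psi0) n T) \<and>
           (\<lambda>n. real (round_complexity c (lcl_solution r0 psi0) n) + 1)
             \<in> \<Theta>(\<lambda>n. real (round_complexity c P n) + 1) \<and>
           (\<forall>n L. lcl_solution r0 psi0 n L \<longrightarrow> P n L) \<and>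
           O1_mendable r0 psi0"
proof -
  define R0 where "R0 = round_complexity c P"
  have R0: "solvable_in_rounds c P n (R0 n)" "R0 n \<le> T n" for n
    using solvable_round_complexity[OF T] unfolding R0_def by blast+
  obtain N1 where N1: "\<And>n. N1 \<le> n \<Longrightarrow> 5 * Suc (T n) \<le> n"
    using eventually_log_star_small[OF small] by blast
  \<comment> \<open>The algorithm with the optimal number R0 of rounds is taken, so that later
    bounds are in terms of R0; R0 \<le> T and 5(T + 1) \<le> n give 4 R0 + 5 \<le> n.\<close>
  have fast: "\<exists>A. fast_algorithm Cedge Cnode S A n (R0 n) c" if n: "N1 \<le> n" for n
  proof -
    obtain A where A: "unoriented_alg A"
      "\<And>ids. valid_ids c n ids \<Longrightarrow> P n (\<lambda>i. A n (local_view (R0 n) n ids i))"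
      using R0(1)[of n] unfolding solvable_in_rounds_def by blast
    have "fast_algorithm Cedge Cnode S A n (R0 n) c"
      by unfold_locales (use A c N1[OF n] R0(2)[of n] in \<open>auto simp: P_def\<close>)
    then show ?thesis by blast
  qed
  \<comment> \<open>A state with a loop is preferred. If none is available, no flexible state has a
    loop, as the colouring requires of every output.\<close>
  obtain q where q: "flexible q" "(q, q) \<in> R \<or> (\<forall>e. flexible e \<longrightarrow> (e, e) \<notin> R)"
    using fast[of N1] ex_flexible by (meson order_refl)
  interpret flexible_state Cedge Cnode S q by unfold_locales (rule q)
  obtain s h K where "s \<in> S" "0 < h" "\<And>k x hx y hy. K \<le> k \<Longrightarrow> terminal s h x hx \<Longrightarrow> terminal s h y hy \<Longrightarrow>
      \<exists>p. walk k x hx y hy p"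
    using walks_between_terminals by blast
  then interpret terminal_walks Cedge Cnode S q s h K by unfold_locales auto
  have "\<exists>C N0. \<forall>n\<ge>N0. \<forall>N. solvable_in_rounds c (restricted h N) n (C * Suc (R0 n))"
  proof (cases "(q, q) \<in> R")
    case True
    from solvable_of_loop[OF this, of c] obtain T1 where
      T1: "\<And>n N T'. K + 2 \<le> n \<Longrightarrow> T1 \<le> T' \<Longrightarrow> solvable_in_rounds c (restricted h N) n T'" by blast
    have "solvable_in_rounds c (restricted h N) n (T1 * Suc (R0 n))" if "K + 2 \<le> n" for n N
      by (rule T1[OF that]) simp
    then show ?thesis by blast
  next
    case False
    then have "\<And>e. flexible e \<Longrightarrow> (e, e) \<notin> R" using q(2) by blast
    from solvable_of_loop_free[OF this, of c] obtain C where
      "\<And>A n T N. fast_algorithm Cedge Cnode S A n T c \<Longrightarrow> K + 2 \<le> n \<Longrightarrow>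
        solvable_in_rounds c (restricted h N) n (C * Suc T)" by blast
    then have "solvable_in_rounds c (restricted h N) n (C * Suc (R0 n))" if "max N1 (K + 2) \<le> n" for n N
      using fast[of n] that by auto
    then show ?thesis by blast
  qed
  then obtain C N0 where "\<And>n N. N0 \<le> n \<Longrightarrow> solvable_in_rounds c (restricted h N) n (C * Suc (R0 n))" by blast
  then show ?thesis using mendable_restriction[OF c, of T N0 C] T unfolding P_def R0_def by blast
qed

end

theorem theoremB1:
  fixes Cedge Cnode :: "('g::finite \<times> 'g) set"
    and Cstart Cend :: "'g set"
    and c :: nat
  assumes "c \<ge> 1"
    and "symmetric_necl Cedge Cnode Cstart Cend"
    and "\<exists>T :: nat \<Rightarrow> nat. (\<lambda>n. real (T n)) \<in> O(\<lambda>n. real (log_star n)) \<and>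
           (\<forall>n. solvable_in_rounds c (necl_solution Cedge Cnode Cstart Cend) n (T n))"
  shows "\<exists>(r0 :: nat) (psi0 :: ('g \<times> 'g) list \<Rightarrow> nat \<Rightarrow> bool).
           orientation_invariant psi0 \<and>
           (\<forall>n. \<exists>T. solvable_in_rounds c (lcl_solution r0 psi0) n T) \<and>
           (\<lambda>n. real (round_complexity c (lcl_solution r0 psi0) n) + 1)
             \<in> \<Theta>(\<lambda>n. real (round_complexity c (necl_solution Cedge Cnode Cstart Cend) n) + 1) \<and>
           (\<forall>n L. lcl_solution r0 psi0 n L \<longrightarrow> necl_solution Cedge Cnode Cstart Cend n L) \<and>
           O1_mendable r0 psi0"
proof -
  interpret sym_lcl Cedge Cnode Cstart
    using assms(2) by unfold_locales (auto simp: symmetric_necl_def)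
  have "Cend = Cstart" using assms(2) by (simp add: symmetric_necl_def)
  then show ?thesis using assms(1,3) ex_mendable_restriction by blast
qed

end
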